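(* Let $r\geq 2$ and $n,k_1,k_2,\dots,k_r$ be positive integers. Let $\mathcal F_1\subseteq\binom{[n]}{k_1},\mathcal F_2\subseteq\binom{[n]}{k_2},\dots,\mathcal F_r\subseteq\binom{[n]}{k_r}$ be non-empty cross-intersecting families with $|\mathcal F_{i^*}|\geq\binom{n-1}{k_{i^*}-1}$ for some $i^*\in[r]$. Let $\bar{k}=\min\{k_i:i\in[r]\setminus\{i^*\}\}$. If $n\geq k_i+k_{i^*}$ for every $i\in[r]\setminus\{i^*\}$, then $$\sum_{i=1}^{r}|\mathcal F_i|\leq\max\left\{\binom{n}{k_{i^*}}-\binom{n-\bar{k}}{k_{i^*}}+\sum_{i\in[r]\setminus\{i^*\}}\binom{n-\bar{k}}{k_i-\bar{k}},\ \sum_{i=1}^{r}\binom{n-1}{k_i-1}\right\}$$ with equality if and only if (1) if $k_i=\bar{k}$ for every $i\in[r]\setminus\{i^*\}$ and $n=\bar{k}+k_{i^*}$, then (i) when $r=2$, $\mathcal F_{i^*}=\binom{[n]}{k_{i^*}}\setminus\overline{\mathcal F_{3-i^*}}$ and $1\leq|\mathcal F_{3-i^*}|\leq\binom{n-1}{\bar{k}-1}$; (ii) when $r>2$ and $n>2\bar{k}$, there exists $x\in[n]$ such that $\mathcal F_{i^*}=\{F\in\binom{[n]}{k_{i^*}}:x\in F\}$ and $\mathcal F_i=\{F\in\binom{[n]}{\bar{k}}:x\in F\}$ for every $i\in[r]\setminus\{i^*\}$; (iii) when $r>2$ and $n\leq 2\bar{k}$, $\mathcal F_i=\mathcal F$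 for every $i\in[r]\setminus\{i^*\}$ and $\mathcal F_{i^*}=\binom{[n]}{k_{i^*}}\setminus\overline{\mathcal F}$, where $\mathcal F\subseteq\binom{[n]}{\bar{k}}$ is an intersecting family with $|\mathcal F|=\binom{n-1}{\bar{k}-1}$; (2) if $n>\bar{k}+k_{i^*}$, then there exists $S\in\binom{[n]}{s}$ with $s=1$ or $\bar{k}$ such that $\mathcal F_{i^*}=\{F\in\binom{[n]}{k_{i^*}}:S\cap F\neq\emptyset\}$ and $\mathcal F_i=\{F\in\binom{[n]}{k_i}:S\subseteq F\}$ for every $i\in[r]\setminus\{i^*\}$.
   Context: $[n]=\{1,2,\dots,n\}$ and $\binom{[n]}{k}$ is the family of all $k$-element subsets of $[n]$. Families $\mathcal F_1\subseteq\binom{[n]}{k_1},\dots,\mathcal F_r\subseteq\binom{[n]}{k_r}$ are cross-intersecting if $|F_i\cap F_j|\geq 1$ for all $1\leq i<j\leq r$ and all $F_i\in\mathcal F_i$, $F_j\in\mathcal F_j$; they are non-empty if $\mathcal F_i\neq\emptyset$ for every $i\in[r]$. A family $\mathcal F$ is intersecting if $|F\cap F'|\geq 1$ for all $F,F'\in\mathcal F$. For a family $\mathcal F$ of subsets of $[n]$, $\overline{\mathcal F}=\{[n]\setminus F:F\in\mathcal F\}$.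
   Formalization: In (2), s = 1 is allowed only if the second term attains the maximum and s = k̄ only if the first does; otherwise the "if" direction fails, e.g. r=2, n=4, k_{i*}=1, k̄=2, S={1,2} gives sum 3 while the maximum is 4. *)

theory Defs
  imports Main "HOL-Library.Ramsey"
begin

text \<open>
  The ground set $[n]$ is \<open>{1..n}\<close>, and the family of all its \<open>k\<close>-element subsets is
  \<open>nsets {1..n} k\<close>. The families \<open>F 1, ..., F r\<close> are given by a function on indices, of which
  only the values on \<open>{1..r}\<close> matter. All members of the families are finite, so \<open>card\<close> below
  is the genuine cardinality.
\<close>

definition cross_intersecting :: "nat \<Rightarrow> (nat \<Rightarrow> 'a set set) \<Rightarrow> bool" where
  "cross_intersecting r F \<longleftrightarrow>
     (\<forall>i j. 1 \<le> i \<and> i < j \<and> j \<le> r \<longrightarrow> (\<forall>A\<in>F i. \<forall>B\<in>F j. card (A \<inter> B) \<ge> 1))"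

definition intersecting :: "'a set set \<Rightarrow> bool" where
  "intersecting \<F> \<longleftrightarrow> (\<forall>A\<in>\<F>. \<forall>B\<in>\<F>. card (A \<inter> B) \<ge> 1)"

definition complements :: "nat \<Rightarrow> nat set set \<Rightarrow> nat set set" where
  "complements n \<F> = {{1..n} - A | A. A \<in> \<F>}"

end

theory Submission imports Defs begin

text \<open>
  Write \<open>V = {1..n}\<close> and let \<open>X\<close> consist of the complements of the members of \<open>F istar\<close>, which are
  \<open>m\<close>-sets with \<open>m = n - k istar\<close>. Then \<open>F i\<close> is disjoint from the family of \<open>k i\<close>-subsets of
  members of \<open>X\<close>, so lower bounds for iterated shadows of \<open>X\<close> are upper bounds for \<open>F i\<close>. A member \<open>S\<close>
  of a family with \<open>k i = kbar\<close> is contained in no member of \<open>X\<close>. The key estimate is that, as soon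
  as \<open>X\<close> has at least \<open>(n - 1) choose m\<close> members, the surplus of \<open>X\<close> over \<open>(n - 1) choose m\<close>, divided by
  the surplus of the family of all \<open>m\<close>-sets that do not contain \<open>S\<close>, does not decrease when passing
  to shadows. As in Frankl's proof of the Kruskal-Katona theorem, one shifts towards a point \<open>e\<close>
  outside \<open>S\<close> and splits \<open>X\<close> into link and deletion of \<open>e\<close>; by Pascal's rule the induction closes
  exactly. Hence the sum of all \<open>card (F i)\<close> lies below a function that is affine in \<open>card (F istar)\<close> and takes
  the values \<open>M2\<close> and \<open>M1\<close> at the two ends of the admissible range. Strictness of the estimate in the
  interior excludes further extremal configurations, and at the end \<open>M2\<close> the family \<open>X\<close> and its
  shadow have the sizes of those of a family of all \<open>m\<close>-sets missing one point, which forces \<open>X\<close> to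
  be such a family.
\<close>

section \<open>Shadows and shifting\<close>

definition shadow :: "'a set set \<Rightarrow> 'a set set" where
  "shadow X = {A - {a} | A a. A \<in> X \<and> a \<in> A}"

definition link :: "'a \<Rightarrow> 'a set set \<Rightarrow> 'a set set" where
  "link e X = {B. e \<notin> B \<and> insert e B \<in> X}"

definition deletion :: "'a \<Rightarrow> 'a set set \<Rightarrow> 'a set set" where
  "deletion e X = {A \<in> X. e \<notin> A}"

text \<open>This is the Erdos-Ko-Rado compression, which replaces \<open>j\<close> by
  \<open>e\<close> wherever the result is not yet a member. It is given by a membership condition on
  the resulting sets rather than as an image, so that passing to shadows and links becomes a case
  distinction on how a set meets \<open>{e, j}\<close>.\<close>

definition shift :: "'a \<Rightarrow> 'a \<Rightarrow> 'a set set \<Rightarrow> 'a set set" where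
  "shift e j X = {C.
     if e \<in> C \<and> j \<notin> C then C \<in> X \<or> insert j (C - {e}) \<in> X
     else if j \<in> C \<and> e \<notin> C then C \<in> X \<and> insert e (C - {j}) \<in> X
     else C \<in> X}"

text \<open>A member may meet \<open>S\<close> but has to miss at least one of its points. For
  \<open>S\<close> inside \<open>V\<close> these are the complements of the sets that meet
  \<open>S\<close>; for a singleton \<open>S\<close> they are the sets missing that point.\<close>

definition avoiding :: "'a set \<Rightarrow> 'a set \<Rightarrow> nat \<Rightarrow> 'a set set" where
  "avoiding V S m = {A \<in> nsets V m. \<not> S \<subseteq> A}"

lemma nsets_iff: "finite V \<Longrightarrow> A \<in> nsets V m \<longleftrightarrow> A \<subseteq> V \<and> card A = m"
  by (auto simp: nsets_def intro: finite_subset)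

lemma finite_subfamily: "finite V \<Longrightarrow> X \<subseteq> nsets V m \<Longrightarrow> finite X"
  by (meson finite_imp_finite_nsets finite_subset)

lemma shadow_subset:
  assumes "finite V" "X \<subseteq> nsets V m"
  shows "shadow X \<subseteq> nsets V (m - 1)"
proof
  fix B assume "B \<in> shadow X"
  then obtain A a where A: "A \<in> X" "a \<in> A" "B = A - {a}" by (auto simp: shadow_def)
  with assms have "A \<subseteq> V" "card A = m" by (auto simp: nsets_iff subset_iff)
  thus "B \<in> nsets V (m - 1)" using A assms(1) by (auto simp: nsets_iff)
qed

lemma link_subset:
  assumes "finite V" "X \<subseteq> nsets V m"
  shows "link e X \<subseteq> nsets (V - {e}) (m - 1)"
proof
  fix B assume "B \<in> link e X"
  hence B: "e \<notin> B" "insert e B \<subseteq> V" "card (insert e B) = m"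
    using assms by (auto simp: link_def nsets_iff subset_iff)
  moreover from B assms(1) have "finite B" by (meson finite_insert finite_subset)
  ultimately show "B \<in> nsets (V - {e}) (m - 1)"
    using assms(1) by (auto simp: nsets_iff)
qed

lemma deletion_subset:
  assumes "finite V" "X \<subseteq> nsets V m"
  shows "deletion e X \<subseteq> nsets (V - {e}) m"
  using assms by (auto simp: deletion_def nsets_iff subset_iff)

lemma card_link: "card (link e X) = card {A \<in> X. e \<in> A}"
proof -
  have "bij_betw (insert e) (link e X) {A \<in> X. e \<in> A}"
    by (rule bij_betw_byWitness[where f' = "\<lambda>A. A - {e}"])
       (auto simp: link_def insert_absorb)
  thus ?thesis by (rule bij_betw_same_card)
qed

lemma card_split:
  assumes "finite X"
  shows "card X = card (link e X) + card (deletion e X)"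
proof -
  have "card X = card {A \<in> X. e \<in> A} + card {A \<in> X. e \<notin> A}"
    using assms by (subst card_Un_disjoint[symmetric]) (auto intro: arg_cong[where f = card])
  thus ?thesis by (simp add: card_link deletion_def)
qed

lemma finite_shadow:
  assumes "finite V" "X \<subseteq> nsets V m"
  shows "finite (shadow X)"
  using assms shadow_subset finite_subfamily by metis

text \<open>Deleting a point commutes with exchanging \<open>j\<close> for \<open>e\<close> unless
  the deleted point is itself \<open>e\<close> or \<open>j\<close>. These exceptional deletions
  either start from a set with both points, which the shift leaves alone, or lead to a set with
  neither, which the set before the exchange produces as well.\<close>

lemma shadow_shift:
  assumes "e \<noteq> j"
  shows "shadow (shift e j X) \<subseteq> shift e j (shadow X)"
proof
  fix B assume "B \<in> shadow (shift e j X)"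
  then obtain C c where C: "C \<in> shift e j X" "c \<in> C" "B = C - {c}"
    by (auto simp: shadow_def)
  have sh: "A - {a} \<in> shadow X" if "A \<in> X" "a \<in> A" for A a
    using that by (auto simp: shadow_def)
  have sh': "D \<in> shadow X" if "A \<in> X" "a \<in> A" "D = A - {a}" for A a D
    using that by (auto simp: shadow_def)
  consider "e \<in> B" "j \<notin> B" | "j \<in> B" "e \<notin> B" | "e \<in> B" "j \<in> B" | "e \<notin> B" "j \<notin> B" by blast
  thus "B \<in> shift e j (shadow X)"
  proof cases
    case 1
    show ?thesis
    proof (cases "j \<in> C")
      case True
      hence "C \<in> X" using C 1 by (auto simp: shift_def)
      thus ?thesis using 1 C sh by (auto simp: shift_def)
    next
      case False
      hence "C \<in> X \<or> insert j (C - {e}) \<in> X" using C 1 by (auto simp: shift_def)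
      moreover have "insert j (B - {e}) = insert j (C - {e}) - {c}" "c \<in> insert j (C - {e})"
        using C 1 False by auto
      ultimately show ?thesis using 1 C sh sh' by (auto simp: shift_def)
    qed
  next
    case 2
    show ?thesis
    proof (cases "e \<in> C")
      case True
      hence "C \<in> X" "c = e" using C 2 by (auto simp: shift_def)
      moreover have "insert e (B - {j}) = C - {j}" "j \<in> C" using C 2 True by auto
      ultimately show ?thesis using 2 C sh by (auto simp: shift_def)
    next
      case False
      hence "C \<in> X \<and> insert e (C - {j}) \<in> X" using C 2 by (auto simp: shift_def)
      moreover have "insert e (B - {j}) = insert e (C - {j}) - {c}" "c \<in> insert e (C - {j})"
        using C 2 False by auto
      ultimately show ?thesis using 2 C sh sh' by (auto simp: shift_def)
    qed
  next
    case 3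
    hence "C \<in> X" using C by (auto simp: shift_def)
    thus ?thesis using 3 C sh by (auto simp: shift_def)
  next
    case 4
    have "B \<in> shadow X"
    proof (cases "e \<in> C \<or> j \<in> C")
      case False
      thus ?thesis using C sh by (auto simp: shift_def)
    next
      case True
      hence "C \<in> X \<or> (c = e \<and> j \<notin> C \<and> insert j (C - {e}) \<in> X)"
        using C 4 by (auto simp: shift_def)
      moreover have "B = insert j (C - {e}) - {j}" if "c = e" "j \<notin> C"
        using C 4 that by auto
      ultimately show ?thesis using C sh sh'[of "insert j (C - {e})" j] by auto
    qed
    thus ?thesis using 4 by (auto simp: shift_def)
  qed
qed

lemma shift_subset:
  assumes "finite V" "X \<subseteq> nsets V m" "e \<in> V" "j \<in> V"
  shows "shift e j X \<subseteq> nsets V m"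
proof
  fix C assume C: "C \<in> shift e j X"
  show "C \<in> nsets V m"
  proof (cases "C \<in> X")
    case False
    hence C': "e \<in> C" "j \<notin> C" "insert j (C - {e}) \<in> X"
      using C by (auto simp: shift_def split: if_splits)
    hence "insert j (C - {e}) \<subseteq> V" "card (insert j (C - {e})) = m"
      using assms by (auto simp: nsets_iff subset_iff)
    moreover from this have "finite (C - {e})" using assms(1) by (meson finite_insert finite_subset)
    ultimately have "C \<subseteq> V" "finite C" "card C = m"
      using C' assms(3) card_Suc_Diff1[of C e] by auto
    thus ?thesis using assms(1) by (simp add: nsets_iff)
  qed (use assms in auto)
qed

lemma finite_shift:
  assumes "finite X" "e \<noteq> j"
  shows "finite (shift e j X)"
proof (rule finite_subset)
  show "shift e j X \<subseteq> X \<union> (\<lambda>A. insert e (A - {j})) ` X"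
  proof
    fix C assume C: "C \<in> shift e j X"
    show "C \<in> X \<union> (\<lambda>A. insert e (A - {j})) ` X"
    proof (cases "C \<in> X")
      case False
      hence C': "e \<in> C" "j \<notin> C" "insert j (C - {e}) \<in> X"
        using C by (auto simp: shift_def split: if_splits)
      moreover from C' assms(2) have "C = insert e (insert j (C - {e}) - {j})" by auto
      ultimately show ?thesis by (metis UnI2 imageI)
    qed auto
  qed
qed (use assms in simp)

text \<open>On the sets meeting \<open>{e, j}\<close> in one point, a shift replaces the two links, as subsets of
  the complement of \<open>{e, j}\<close>, by their union and intersection.\<close>

lemma card_shift:
  assumes "finite X" "e \<noteq> j"
  shows "card (shift e j X) = card X"
proof -
  define R where "R Y = {A \<in> Y. e \<in> A \<longleftrightarrow> j \<in> A}" for Y :: "'a set set"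
  define P where "P a b Y = {B. a \<notin> B \<and> b \<notin> B \<and> insert a B \<in> Y}" for a b :: 'a and Y
  have fP: "finite (P a b Y)" if "finite Y" for a b and Y :: "'a set set"
    by (rule finite_subset[of _ "(\<lambda>A. A - {a}) ` Y"]) (use that in \<open>auto simp: P_def image_iff intro!: bexI\<close>)
  have bij: "card (P a b Y) = card {A \<in> Y. a \<in> A \<and> b \<notin> A}" if "a \<noteq> b" for a b and Y :: "'a set set"
  proof (rule bij_betw_same_card[of "insert a"])
    show "bij_betw (insert a) (P a b Y) {A \<in> Y. a \<in> A \<and> b \<notin> A}"
      by (rule bij_betw_byWitness[where f' = "\<lambda>A. A - {a}"])
         (use that in \<open>auto simp: P_def insert_absorb\<close>)
  qed
  have c: "card Y = card (R Y) + card (P e j Y) + card (P j e Y)" if "finite Y" for Y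
  proof -
    have "Y = R Y \<union> {A \<in> Y. e \<in> A \<and> j \<notin> A} \<union> {A \<in> Y. j \<in> A \<and> e \<notin> A}"
      by (auto simp: R_def)
    also have "card \<dots> = card (R Y) + card {A \<in> Y. e \<in> A \<and> j \<notin> A} + card {A \<in> Y. j \<in> A \<and> e \<notin> A}"
      using that by (subst card_Un_disjoint, force simp: R_def, force, force simp: R_def,
          subst card_Un_disjoint) (auto simp: R_def)
    finally show ?thesis using assms(2) by (simp add: bij)
  qed
  have fin: "finite (shift e j X)" using assms by (rule finite_shift)
  have "R (shift e j X) = R X" by (auto simp: R_def shift_def split: if_splits)
  moreover have "P e j (shift e j X) = P e j X \<union> P j e X"
    using assms(2) by (auto simp: P_def shift_def)
  moreover have "P j e (shift e j X) = P e j X \<inter> P j e X"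
    using assms(2) by (auto simp: P_def shift_def)
  ultimately show ?thesis
    using c[OF fin] c[OF assms(1)] card_Un_Int[OF fP fP, of X X e j j e] assms(1) by simp
qed

lemma shift_avoiding:
  assumes "\<forall>A\<in>X. \<not> S \<subseteq> A" "e \<notin> S"
  shows "\<forall>A\<in>shift e j X. \<not> S \<subseteq> A"
proof
  fix C assume C: "C \<in> shift e j X"
  show "\<not> S \<subseteq> C"
  proof (cases "C \<in> X")
    case False
    hence "insert j (C - {e}) \<in> X" using C by (auto simp: shift_def split: if_splits)
    hence "\<not> S \<subseteq> insert j (C - {e})" using assms(1) by simp
    then obtain x where "x \<in> S" "x \<notin> insert j (C - {e})" by auto
    thus ?thesis using assms(2) by auto
  qed (use assms in auto)
qed

text \<open>Shifting never removes a set containing \<open>e\<close>. If no new one appeared, the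
  shifted family would lie in \<open>X\<close> and, having equally many members, be
  \<open>X\<close>. This strict growth makes repeated shifting terminate.\<close>

lemma card_link_shift:
  assumes "finite V" "X \<subseteq> nsets V m" "e \<in> V" "j \<in> V" "e \<noteq> j" "shift e j X \<noteq> X"
  shows "card (link e X) < card (link e (shift e j X))"
proof -
  have fin: "finite X" "finite (shift e j X)"
    using assms finite_subfamily shift_subset by metis+
  have sub: "{A \<in> X. e \<in> A} \<subseteq> {A \<in> shift e j X. e \<in> A}"
    by (auto simp: shift_def)
  have "{A \<in> X. e \<in> A} \<noteq> {A \<in> shift e j X. e \<in> A}"
  proof
    assume eq: "{A \<in> X. e \<in> A} = {A \<in> shift e j X. e \<in> A}"
    have "shift e j X \<subseteq> X"
      using eq by (auto simp: shift_def split: if_splits)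
    with assms(5,6) card_shift[OF fin(1) assms(5)] fin card_subset_eq show False by metis
  qed
  hence "{A \<in> X. e \<in> A} \<subset> {A \<in> shift e j X. e \<in> A}" using sub by blast
  thus ?thesis using fin by (simp add: card_link psubset_card_mono)
qed

lemma card_shadow_shift:
  assumes "finite V" "X \<subseteq> nsets V m" "e \<noteq> j"
  shows "card (shadow (shift e j X)) \<le> card (shadow X)"
proof -
  have f: "finite (shadow X)" using assms finite_shadow by metis
  have "card (shift e j (shadow X)) = card (shadow X)" by (rule card_shift[OF f assms(3)])
  moreover have "finite (shift e j (shadow X))" by (rule finite_shift[OF f assms(3)])
  ultimately show ?thesis using shadow_shift[OF assms(3)] card_mono by metis
qed

section \<open>Families stable under shifts towards one point\<close>

definition stable :: "'a set \<Rightarrow> 'a \<Rightarrow> 'a set set \<Rightarrow> bool" where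
  "stable V e X \<longleftrightarrow> (\<forall>j\<in>V - {e}. shift e j X = X)"

text \<open>Each nontrivial shift enlarges the link of \<open>e\<close>, whose size is bounded by
  the number of \<open>(m - 1)\<close>-subsets of \<open>V - {e}\<close>; the remaining gap is the
  induction measure. A property thus holds in general once it holds for stable families and can be
  pulled back along single shifts.\<close>

lemma shift_induct [consumes 3, case_names stable shift]:
  assumes "finite V" "e \<in> V" "X \<subseteq> nsets V m"
    and st: "\<And>X. X \<subseteq> nsets V m \<Longrightarrow> stable V e X \<Longrightarrow> P X"
    and sh: "\<And>X j. X \<subseteq> nsets V m \<Longrightarrow> j \<in> V \<Longrightarrow> e \<noteq> j \<Longrightarrow> P (shift e j X) \<Longrightarrow> P X"
  shows "P X"
  using assms(3)
proof (induction "card (nsets (V - {e}) (m - 1)) - card (link e X)" arbitrary: X rule: less_induct)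
  case less
  show ?case
  proof (cases "stable V e X")
    case False
    then obtain j where j: "j \<in> V" "e \<noteq> j" "shift e j X \<noteq> X" by (auto simp: stable_def)
    have s: "shift e j X \<subseteq> nsets V m" using shift_subset less.prems j assms by metis
    have "card (link e (shift e j X)) \<le> card (nsets (V - {e}) (m - 1))"
      by (intro card_mono finite_imp_finite_nsets link_subset s) (use assms in auto)
    moreover have "card (link e X) < card (link e (shift e j X))"
      using card_link_shift[OF assms(1) less.prems assms(2)] j by blast
    ultimately show ?thesis using less.hyps[of "shift e j X"] s sh less.prems j by auto
  qed (use st less.prems in blast)
qed

text \<open>In a stable family a point \<open>a\<close> of a member \<open>A\<close> without
  \<open>e\<close> can be exchanged for \<open>e\<close>, so \<open>A - {a}\<close> extended by
  \<open>e\<close> is again a member.\<close>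

lemma stable_shadow_deletion:
  assumes "finite V" "X \<subseteq> nsets V m" "stable V e X"
  shows "shadow (deletion e X) \<subseteq> link e X"
proof
  fix B assume "B \<in> shadow (deletion e X)"
  then obtain A a where A: "A \<in> X" "e \<notin> A" "a \<in> A" "B = A - {a}"
    by (auto simp: shadow_def deletion_def)
  hence "a \<in> V - {e}" using assms by (auto simp: nsets_iff subset_iff)
  hence "A \<in> shift e a X" using assms(3) A by (auto simp: stable_def)
  thus "B \<in> link e X" using A by (auto simp: shift_def link_def)
qed

text \<open>Deleting \<open>e\<close> from the members that contain it gives the link; deleting
  another of their points gives a set of the shadow of the link with \<open>e\<close> adjoined. The
  two kinds are told apart by \<open>e\<close>.\<close>

lemma card_shadow_ge:
  assumes "finite V" "X \<subseteq> nsets V m"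
  shows "card (shadow X) \<ge> card (link e X) + card (shadow (link e X))"
proof -
  have f: "finite (shadow X)" "finite (shadow (link e X))" "finite (link e X)"
    using finite_shadow[OF assms] finite_shadow[OF _ link_subset[OF assms]]
      finite_subfamily[OF _ link_subset[OF assms]] assms(1) by auto
  have s: "link e X \<union> insert e ` shadow (link e X) \<subseteq> shadow X"
  proof
    fix B assume "B \<in> link e X \<union> insert e ` shadow (link e X)"
    thus "B \<in> shadow X"
    proof
      assume "B \<in> link e X"
      hence "insert e B \<in> X" "e \<in> insert e B" "B = insert e B - {e}" by (auto simp: link_def)
      thus ?thesis unfolding shadow_def by blast
    next
      assume "B \<in> insert e ` shadow (link e X)"
      then obtain A a where "e \<notin> A" "insert e A \<in> X" "a \<in> A" "B = insert e (A - {a})"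
        by (auto simp: link_def shadow_def)
      moreover from this have "B = insert e A - {a}" by auto
      ultimately show ?thesis by (auto simp: shadow_def)
    qed
  qed
  have "e \<notin> B" if "B \<in> shadow (link e X)" for B
    using that by (auto simp: shadow_def link_def)
  hence "inj_on (insert e) (shadow (link e X))"
    by (meson inj_onI insert_ident)
  hence "card (link e X) + card (shadow (link e X)) = card (link e X \<union> insert e ` shadow (link e X))"
    using f by (subst card_Un_disjoint) (auto simp: card_image link_def)
  also have "\<dots> \<le> card (shadow X)" using s f by (intro card_mono)
  finally show ?thesis .
qed

section \<open>Shadows of families larger than the sets missing a point\<close>

text \<open>The subtracted number counts the \<open>m\<close>-sets that miss one given point of
  \<open>V\<close>. Values in \<open>int\<close> let the deletion have negative excess although the
  whole family does not. By Pascal's rule the excess is additive over link and deletion.\<close>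

definition excess :: "'a set \<Rightarrow> nat \<Rightarrow> 'a set set \<Rightarrow> int" where
  "excess V m X = int (card X) - int (card V - 1 choose m)"

lemma split_excess:
  assumes "finite V" "e \<in> V" "2 \<le> card V" "1 \<le> m" "X \<subseteq> nsets V m"
  shows "excess V m X = excess (V - {e}) (m - 1) (link e X) + excess (V - {e}) m (deletion e X)"
proof -
  have "card V - 1 choose m = (card V - 2 choose (m - 1)) + (card V - 2 choose m)"
    using assms(3,4) choose_reduce_nat[of "card V - 1" m] by (simp add: numeral_2_eq_2)
  thus ?thesis using card_split[OF finite_subfamily[OF assms(1,5)], of e] assms(1,2)
    by (simp add: excess_def numeral_2_eq_2)
qed

text \<open>A mediant argument with denominators cleared. Here \<open>p0\<close>, \<open>p1\<close>,
  \<open>p2\<close> are excesses of the comparison family on \<open>V - {e}\<close> at levels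
  \<open>m\<close>, \<open>m - 1\<close>, \<open>m - 2\<close>, while \<open>y0\<close>,
  \<open>y1\<close>, \<open>z\<close>, \<open>d\<close> belong to the deletion, the link, the shadow
  of the link and the shadow of \<open>X\<close>. From \<open>y0 / p0 <= y1 / p1 <= z / p2\<close>
  the mediant of the first two is at most \<open>y1 / p1\<close>, and that is at most the mediant of
  the last two. The cleared form also covers vanishing \<open>p0\<close> and
  \<open>p2\<close>.\<close>

lemma weighted_step:
  fixes y0 y1 z d p0 p1 p2 :: int
  assumes "y1 + z \<le> d" "p2 * y1 \<le> p1 * z" "0 < p1" "0 \<le> p0" "0 \<le> p2"
  shows "p1 * y0 \<le> p0 * y1 \<Longrightarrow> (p1 + p2) * (y1 + y0) \<le> (p0 + p1) * d"
    and "p1 * y0 < p0 * y1 \<Longrightarrow> (p1 + p2) * (y1 + y0) < (p0 + p1) * d"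
proof -
  have "(p0 + p1) * ((p1 + p2) * y1) \<le> (p0 + p1) * (p1 * (y1 + z))"
    using assms by (intro mult_left_mono) (auto simp: algebra_simps)
  also have "\<dots> \<le> (p0 + p1) * (p1 * d)"
    using assms by (intro mult_left_mono) auto
  finally have *: "(p1 + p2) * (p0 * y1 + p1 * y1) \<le> p1 * ((p0 + p1) * d)"
    by (simp add: algebra_simps)
  {
    assume "p1 * y0 \<le> p0 * y1"
    hence "(p1 + p2) * (p1 * y0 + p1 * y1) \<le> (p1 + p2) * (p0 * y1 + p1 * y1)"
      using assms by (intro mult_left_mono) auto
    with * have "p1 * ((p1 + p2) * (y1 + y0)) \<le> p1 * ((p0 + p1) * d)"
      by (simp add: algebra_simps)
    thus "(p1 + p2) * (y1 + y0) \<le> (p0 + p1) * d" using assms by simp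
  }
  {
    assume "p1 * y0 < p0 * y1"
    hence "(p1 + p2) * (p1 * y0 + p1 * y1) < (p1 + p2) * (p0 * y1 + p1 * y1)"
      using assms by (intro mult_strict_left_mono) auto
    with * have "p1 * ((p1 + p2) * (y1 + y0)) < p1 * ((p0 + p1) * d)"
      by (simp add: algebra_simps)
    thus "(p1 + p2) * (y1 + y0) < (p0 + p1) * d" using assms by simp
  }
qed

lemma stable_excess:
  assumes V: "finite V" "e \<in> V" "2 \<le> card V" and m: "2 \<le> m" and X: "X \<subseteq> nsets V m"
  shows "excess (V - {e}) (m - 1) (link e X) + excess (V - {e}) (m - 2) (shadow (link e X))
           \<le> excess V (m - 1) (shadow X)"
proof -
  have "card V - 1 choose (m - 1) = (card V - 2 choose (m - 2)) + (card V - 2 choose (m - 1))"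
    using V m choose_reduce_nat[of "card V - 1" "m - 1"] by (simp add: numeral_2_eq_2)
  thus ?thesis using card_shadow_ge[OF V(1) X, of e] V(1,2)
    by (simp add: excess_def numeral_2_eq_2)
qed

text \<open>This is the induction step shared by both comparison families. Stability puts the shadow
  of the deletion inside the link, so a bound for the deletion becomes one for the link. The second
  alternative in \<open>IH0\<close> serves the boundary level \<open>m = card (V - {e})\<close>,
  where no induction hypothesis covers the deletion and the comparison with the link is proved
  directly.\<close>

lemma shifted_step:
  assumes V: "finite V" "e \<in> V" "2 \<le> card V" and m: "2 \<le> m" and X: "X \<subseteq> nsets V m" "stable V e X"
    and ex: "0 \<le> excess V m X"
    and p: "0 < p1" "0 \<le> p0" "0 \<le> p2"
    and IH1: "0 \<le> excess (V - {e}) (m - 1) (link e X) \<Longrightarrow>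
      0 \<le> excess (V - {e}) (m - 2) (shadow (link e X)) \<and>
      p2 * excess (V - {e}) (m - 1) (link e X) \<le> p1 * excess (V - {e}) (m - 2) (shadow (link e X))"
    and IH0: "0 \<le> excess (V - {e}) m (deletion e X) \<Longrightarrow>
      (0 \<le> excess (V - {e}) (m - 1) (shadow (deletion e X)) \<and>
      p1 * excess (V - {e}) m (deletion e X) \<le> p0 * excess (V - {e}) (m - 1) (shadow (deletion e X))) \<or>
      (0 \<le> excess (V - {e}) (m - 1) (link e X) \<and>
      p1 * excess (V - {e}) m (deletion e X) \<le> p0 * excess (V - {e}) (m - 1) (link e X))"
  shows "0 \<le> excess V (m - 1) (shadow X) \<and>
    (p1 + p2) * excess V m X \<le> (p0 + p1) * excess V (m - 1) (shadow X)"
proof -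
  let ?y1 = "excess (V - {e}) (m - 1) (link e X)" and ?y0 = "excess (V - {e}) m (deletion e X)"
  let ?z = "excess (V - {e}) (m - 2) (shadow (link e X))"
  have sum: "excess V m X = ?y1 + ?y0" using split_excess[OF V _ X(1)] m by simp
  have d0: "excess (V - {e}) (m - 1) (shadow (deletion e X)) \<le> ?y1"
    using card_mono[OF _ stable_shadow_deletion[OF V(1) X]]
      finite_subfamily[OF _ link_subset[OF V(1) X(1)]] V(1) by (simp add: excess_def)
  have y: "0 \<le> ?y1 \<and> p1 * ?y0 \<le> p0 * ?y1"
  proof (cases "0 \<le> ?y0")
    case True
    have "p0 * excess (V - {e}) (m - 1) (shadow (deletion e X)) \<le> p0 * ?y1"
      using d0 p by (intro mult_left_mono)
    thus ?thesis using IH0[OF True] d0 by auto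
  next
    case False
    \<comment> \<open>A negative \<open>?y0\<close> forces a positive \<open>?y1\<close>, so the
      left side is at most zero and the right side at least zero.\<close>
    hence "p1 * ?y0 \<le> 0" "0 \<le> ?y1" using p ex sum by (auto simp: mult_le_0_iff)
    moreover from this have "0 \<le> p0 * ?y1" using p by simp
    ultimately show ?thesis by linarith
  qed
  have z: "0 \<le> ?z" "p2 * ?y1 \<le> p1 * ?z" using IH1 y by auto
  have d: "?y1 + ?z \<le> excess V (m - 1) (shadow X)" by (rule stable_excess[OF V m X(1)])
  show ?thesis using weighted_step(1)[OF d z(2) p, of ?y0] y z d sum by simp
qed

lemma excess_shift:
  assumes "finite V" "X \<subseteq> nsets V m" "e \<in> V" "j \<in> V" "e \<noteq> j"
  shows "excess V m (shift e j X) = excess V m X"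
    and "excess V (m - 1) (shadow (shift e j X)) \<le> excess V (m - 1) (shadow X)"
  using card_shift[OF finite_subfamily[OF assms(1,2)] assms(5)] card_shadow_shift[OF assms(1,2,5)]
  by (auto simp: excess_def)

lemma deletion_nsets: "deletion e (nsets V m) = nsets (V - {e}) m"
  by (auto simp: deletion_def nsets_def)

lemma link_nsets:
  assumes "finite V" "e \<in> V" "1 \<le> m"
  shows "link e (nsets V m) = nsets (V - {e}) (m - 1)"
proof
  show "link e (nsets V m) \<subseteq> nsets (V - {e}) (m - 1)"
    using link_subset[OF assms(1) subset_refl] .
  show "nsets (V - {e}) (m - 1) \<subseteq> link e (nsets V m)"
    using assms by (auto simp: link_def nsets_def card_insert_if)
qed

lemma link_avoiding:
  assumes "finite V" "e \<in> V" "1 \<le> m" "e \<notin> S"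
  shows "link e (avoiding V S m) = avoiding (V - {e}) S (m - 1)"
proof -
  have "link e (avoiding V S m) = {A \<in> link e (nsets V m). \<not> S \<subseteq> A}"
    using assms(4) by (auto simp: link_def avoiding_def subset_insert)
  thus ?thesis using assms by (simp add: link_nsets avoiding_def)
qed

lemma deletion_avoiding: "deletion e (avoiding V S m) = avoiding (V - {e}) S m"
  using deletion_nsets[of e V m] by (auto simp: deletion_def avoiding_def)

lemma nsets_card_self:
  assumes "finite V"
  shows "nsets V (card V) = {V}"
proof (intro equalityI subsetI)
  fix A assume "A \<in> nsets V (card V)"
  thus "A \<in> {V}" using card_subset_eq[OF assms, of A] by (simp add: nsets_iff assms)
qed (simp add: nsets_iff assms)

lemma avoiding_subset: "avoiding V S m \<subseteq> nsets V m"
  by (auto simp: avoiding_def)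

lemma excess_mono:
  assumes "finite V" "X \<subseteq> Y" "Y \<subseteq> nsets V m"
  shows "excess V m X \<le> excess V m Y"
  using card_mono[OF finite_subfamily[OF assms(1,3)] assms(2)] by (simp add: excess_def)

lemma excess_avoiding_nonneg:
  assumes "finite V" "x \<in> S" "x \<in> V"
  shows "0 \<le> excess V m (avoiding V S m)"
proof -
  have "nsets (V - {x}) m \<subseteq> avoiding V S m"
    using assms by (auto simp: avoiding_def nsets_def)
  hence "excess V m (nsets (V - {x}) m) \<le> excess V m (avoiding V S m)"
    by (rule excess_mono[OF assms(1) _ avoiding_subset])
  thus ?thesis using assms by (simp add: excess_def card_nsets)
qed

lemma excess_avoiding_pos:
  assumes "finite V" "x \<in> S" "x \<in> V" "z \<in> S" "z \<in> V" "x \<noteq> z" "1 \<le> m" "m < card V"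
  shows "0 < excess V m (avoiding V S m)"
proof -
  \<comment> \<open>The extra member contains \<open>x\<close> but misses \<open>z\<close>: it does
    not contain \<open>S\<close>, and it is not among the sets missing \<open>x\<close>.\<close>
  have "m - 1 \<le> card (V - {x, z})" using assms by (simp add: card_Diff_subset)
  then obtain B where B: "B \<subseteq> V - {x, z}" "card B = m - 1" "finite B"
    using assms(1) by (meson finite_Diff finite_subset obtain_subset_with_card_n)
  have "x \<notin> B" using B by auto
  hence "card (insert x B) = m" using B assms(7) by simp
  hence "insert (insert x B) (nsets (V - {x}) m) \<subseteq> avoiding V S m"
    using assms B by (auto simp: avoiding_def nsets_def)
  hence "excess V m (insert (insert x B) (nsets (V - {x}) m)) \<le> excess V m (avoiding V S m)"
    by (rule excess_mono[OF assms(1) _ avoiding_subset])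
  moreover have "insert x B \<notin> nsets (V - {x}) m" by (auto simp: nsets_def)
  ultimately show ?thesis using assms by (simp add: excess_def card_nsets finite_imp_finite_nsets)
qed

lemma excess_nsets_pos:
  assumes "1 \<le> m" "m \<le> card V" "finite V"
  shows "0 < excess V m (nsets V m)"
  using assms choose_reduce_nat[of "card V" m] by (simp add: excess_def card_nsets)

lemma excess_nsets_nonneg: "finite V \<Longrightarrow> 0 \<le> excess V m (nsets V m)"
  by (simp add: excess_def card_nsets binomial_right_mono)

text \<open>The boundary level of the induction. The shadow of the single set \<open>V - {e}\<close>
  already consists of all its \<open>(m - 1)\<close>-subsets, and stability places this shadow in
  the link.\<close>

lemma stable_link_top:
  assumes V: "finite V" and X: "X \<subseteq> nsets V m" "stable V e X"
    and m: "1 \<le> m" "m = card (V - {e})" and W: "deletion e X = {V - {e}}"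
  shows "link e X = nsets (V - {e}) (m - 1)"
proof
  let ?W = "V - {e}"
  show "link e X \<subseteq> nsets ?W (m - 1)" by (rule link_subset[OF V X(1)])
  show "nsets ?W (m - 1) \<subseteq> link e X"
  proof
    fix B assume "B \<in> nsets ?W (m - 1)"
    hence B: "B \<subseteq> ?W" "B \<noteq> ?W" "card B = card ?W - 1" using m V by (auto simp: nsets_iff)
    then obtain a where a: "a \<in> ?W" "a \<notin> B" by blast
    hence "B = ?W - {a}" using B V by (intro card_subset_eq) auto
    hence "B \<in> shadow (deletion e X)" using W a by (auto simp: shadow_def)
    thus "B \<in> link e X" using stable_shadow_deletion[OF V X] by blast
  qed
qed

text \<open>The comparison family is the full family of \<open>m\<close>-sets. The nonnegativity
  says that a family at least as large as the sets missing a point has a shadow at least as large as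
  theirs; it is carried along because \<open>shifted_step\<close> asks for it at the shadows of link
  and deletion.\<close>

lemma shadow_excess_nsets:
  assumes "finite V" "1 \<le> m" "m < card V" "X \<subseteq> nsets V m" "0 \<le> excess V m X"
  shows "0 \<le> excess V (m - 1) (shadow X) \<and>
    excess V (m - 1) (nsets V (m - 1)) * excess V m X \<le> excess V m (nsets V m) * excess V (m - 1) (shadow X)"
  using assms
proof (induction "card V" arbitrary: V m X rule: less_induct)
  case less
  note V = \<open>finite V\<close>
  show ?case
  proof (cases "m = 1")
    case True
    \<comment> \<open>At level \<open>0\<close> the comparison excess vanishes, so it is enough that
      the shadow is nonempty.\<close>
    have "card X > 0" using less.prems True by (simp add: excess_def)
    then obtain A where A: "A \<in> X" by fastforce
    hence "card A = 1" using less.prems True by (auto simp: nsets_iff)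
    then obtain a where "A = {a}" by (auto simp: card_1_singleton_iff)
    hence "{} \<in> shadow X" using A by (force simp: shadow_def)
    hence "card (shadow X) > 0" using finite_shadow[OF V less.prems(4)] card_gt_0_iff by blast
    thus ?thesis using True V by (simp add: excess_def card_nsets)
  next
    case False
    hence m: "2 \<le> m" and n: "2 \<le> card V" "3 \<le> card V" using less.prems by auto
    then obtain e where e: "e \<in> V" by fastforce
    let ?W = "V - {e}"
    have W: "finite ?W" "card ?W < card V" "card ?W = card V - 1" using V e n by auto
    define p where "p j = excess ?W j (nsets ?W j)" for j
    \<comment> \<open>Pascal's rule splits the comparison excesses in the same way as that of
      \<open>X\<close>.\<close>
    have q: "excess V m (nsets V m) = p m + p (m - 1)" "excess V (m - 1) (nsets V (m - 1)) = p (m - 1) + p (m - 2)"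
      using split_excess[OF V e n(1) _ subset_refl] m e V
      by (auto simp: link_nsets deletion_nsets p_def numeral_2_eq_2)
    have p: "0 < p (m - 1)" "0 \<le> p m" "0 \<le> p (m - 2)"
      unfolding p_def using W m less.prems by (auto intro!: excess_nsets_pos excess_nsets_nonneg)
    show ?thesis using V e less.prems(4) less.prems(5)
    proof (induction rule: shift_induct)
      case (shift X j)
      let ?Y = "shift e j X"
      note ex = excess_shift[OF V shift(1) e shift(2,3)]
      have "excess V m (nsets V m) * excess V (m - 1) (shadow ?Y) \<le> excess V m (nsets V m) * excess V (m - 1) (shadow X)"
        using ex V by (intro mult_left_mono excess_nsets_nonneg) auto
      thus ?case using shift.IH shift.prems ex by auto
    next
      case (stable X)
      have sub: "link e X \<subseteq> nsets ?W (m - 1)" "deletion e X \<subseteq> nsets ?W m"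
        using link_subset deletion_subset V stable by metis+
      show ?case unfolding q
      proof (rule shifted_step[OF V e n(1) m stable(1,2,3) p], goal_cases)
        case 1
        thus ?case
          using less.hyps[OF W(2,1) _ _ sub(1)] m less.prems W by (simp add: p_def numeral_2_eq_2)
      next
        case 2
        show ?case
        proof (cases "m < card ?W")
          case True
          thus ?thesis
            using less.hyps[OF W(2,1) _ _ sub(2)] 2 m less.prems W by (simp add: p_def)
        next
          case False
          \<comment> \<open>The only candidate for a member of the deletion is \<open>?W\<close>. If
            it is absent, the deletion has excess zero; if it is present, stability makes the link
            full and the comparison an equality.\<close>
          hence mW: "m = card ?W" using less.prems W by linarith
          have "nsets ?W m = {?W}" unfolding mW by (rule nsets_card_self[OF W(1)])
          hence "deletion e X = {} \<or> deletion e X = {?W}" using sub(2) by auto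
          thus ?thesis
          proof
            assume "deletion e X = {}"
            hence "excess ?W m (deletion e X) = 0" using mW m by (simp add: excess_def)
            thus ?thesis using stable.prems split_excess[OF V e n(1) _ stable(1)] m p by simp
          next
            assume d: "deletion e X = {?W}"
            hence "nsets ?W (m - 1) = link e X"
              using stable_link_top[OF V stable(1,2)] mW m by simp
            hence "p (m - 1) = excess ?W (m - 1) (link e X)" by (simp add: p_def)
            moreover have "p m = excess ?W m (deletion e X)"
              using d \<open>nsets ?W m = {?W}\<close> by (simp add: p_def)
            ultimately show ?thesis using p by simp
          qed
        qed
      qed
    qed
  qed
qed

section \<open>Families whose members do not contain a fixed set\<close>

lemma avoiding_nsets: "card V \<noteq> m \<Longrightarrow> finite V \<Longrightarrow> avoiding V V m = nsets V m"
  by (auto simp: avoiding_def nsets_iff dest: subset_antisym)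

lemma link_avoids:
  assumes "X \<subseteq> avoiding V S m" "finite V" "e \<in> V" "1 \<le> m" "e \<notin> S"
  shows "link e X \<subseteq> avoiding (V - {e}) S (m - 1)"
  unfolding link_avoiding[OF assms(2-5), symmetric] using assms(1) by (auto simp: link_def)

lemma deletion_avoids:
  assumes "X \<subseteq> avoiding V S m"
  shows "deletion e X \<subseteq> avoiding (V - {e}) S m"
  unfolding deletion_avoiding[symmetric] using assms by (auto simp: deletion_def)

lemma shift_avoids:
  assumes "finite V" "X \<subseteq> avoiding V S m" "e \<in> V" "j \<in> V" "e \<notin> S"
  shows "shift e j X \<subseteq> avoiding V S m"
proof -
  have "X \<subseteq> nsets V m" "\<forall>A\<in>X. \<not> S \<subseteq> A" using assms(2) by (auto simp: avoiding_def)
  thus ?thesis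
    using shift_subset[OF assms(1) _ assms(3,4), of X m] shift_avoiding[of X S e j] assms(5)
    by (auto simp: avoiding_def)
qed

text \<open>The shifts go towards a point \<open>e\<close> outside \<open>S\<close>, which keeps the
  family inside \<open>avoiding\<close>; passing to link and deletion shrinks \<open>V\<close> but
  not \<open>S\<close>. The recursion ends at level \<open>1\<close> or when \<open>S = V\<close>,
  where \<open>shadow_excess_nsets\<close> applies. Two points of \<open>S\<close> make the
  comparison excess at level \<open>m - 1\<close> positive, as the mediant step demands.\<close>

lemma shadow_excess_avoiding:
  assumes "finite V" "S \<subseteq> V" "x \<in> S" "z \<in> S" "x \<noteq> z" "1 \<le> m" "m < card V"
    and "X \<subseteq> avoiding V S m" "0 \<le> excess V m X"
  shows "excess V (m - 1) (avoiding V S (m - 1)) * excess V m X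
    \<le> excess V m (avoiding V S m) * excess V (m - 1) (shadow X)"
  using assms
proof (induction "card V" arbitrary: V m X rule: less_induct)
  case less
  note V = \<open>finite V\<close>
  have xz: "x \<in> S" "x \<in> V" "z \<in> S" "z \<in> V" "x \<noteq> z" using less.prems by auto
  hence n: "2 \<le> card V" using card_mono[of V "{x, z}"] V by auto
  have X: "X \<subseteq> nsets V m" using less.prems avoiding_subset by blast
  consider "m = 1" | "S = V" | "2 \<le> m" "S \<noteq> V" using less.prems by linarith
  thus ?case
  proof cases
    case 1
    \<comment> \<open>Level \<open>0\<close> has only the empty set, which does not contain
      \<open>S\<close>, so the comparison excess there is zero.\<close>
    have "{x, z} \<subseteq> S" using xz by blast
    hence "avoiding V S 0 = {{}}" using xz by (auto simp: avoiding_def nsets_def)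
    hence "excess V 0 (avoiding V S 0) = 0" by (simp add: excess_def)
    moreover have "0 \<le> excess V 0 (shadow X)"
      using shadow_excess_nsets[OF V _ _ X] 1 less.prems by simp
    ultimately show ?thesis using 1 excess_avoiding_nonneg[OF V xz(1,2)] by simp
  next
    case 2
    thus ?thesis using shadow_excess_nsets[OF V _ _ X] less.prems by (simp add: avoiding_nsets)
  next
    case 3
    then obtain e where e: "e \<in> V" "e \<notin> S" using less.prems by blast
    let ?W = "V - {e}"
    have W: "finite ?W" "card ?W < card V" "card ?W = card V - 1" using V e n by auto
    have xzW: "S \<subseteq> ?W" "x \<in> ?W" "z \<in> ?W" using xz e less.prems by auto
    define p where "p j = excess ?W j (avoiding ?W S j)" for j
    have q: "excess V m (avoiding V S m) = p m + p (m - 1)"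
      "excess V (m - 1) (avoiding V S (m - 1)) = p (m - 1) + p (m - 2)"
      using split_excess[OF V e(1) n _ avoiding_subset] 3 e V
      by (auto simp: link_avoiding deletion_avoiding p_def numeral_2_eq_2)
    have p: "0 < p (m - 1)" "0 \<le> p m" "0 \<le> p (m - 2)"
      unfolding p_def using W 3 less.prems xz xzW
      by (auto intro!: excess_avoiding_pos[of _ x _ z] excess_avoiding_nonneg[of _ x])
    show ?thesis using V e(1) X less.prems(8,9)
    proof (induction rule: shift_induct)
      case (shift X j)
      let ?Y = "shift e j X"
      note ex = excess_shift[OF V shift(1) e(1) shift(2,3)]
      have "excess V m (avoiding V S m) * excess V (m - 1) (shadow ?Y)
          \<le> excess V m (avoiding V S m) * excess V (m - 1) (shadow X)"
        using ex V xz by (intro mult_left_mono excess_avoiding_nonneg) auto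
      thus ?case using shift.IH shift.prems ex shift_avoids[OF V _ e(1) shift(2) e(2)] by auto
    next
      case (stable X)
      have sub: "link e X \<subseteq> avoiding ?W S (m - 1)" "deletion e X \<subseteq> avoiding ?W S m"
        using link_avoids deletion_avoids V stable e 3 by (metis One_nat_def Suc_leD numeral_2_eq_2)+
      note subn = sub[THEN subset_trans[OF _ avoiding_subset]]
      have "0 \<le> excess V (m - 1) (shadow X) \<and>
        (p (m - 1) + p (m - 2)) * excess V m X \<le> (p m + p (m - 1)) * excess V (m - 1) (shadow X)"
      proof (rule shifted_step[OF V e(1) n 3(1) stable(1,2) stable(4) p], goal_cases)
        case 1
        thus ?case
          using less.hyps[OF W(2,1) xzW(1) xz(1,3,5) _ _ sub(1)]
            shadow_excess_nsets[OF W(1) _ _ subn(1)] 3 less.prems W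
          by (simp add: p_def numeral_2_eq_2)
      next
        case 2
        show ?case
        proof (cases "m < card ?W")
          case True
          thus ?thesis
            using less.hyps[OF W(2,1) xzW(1) xz(1,3,5) _ _ sub(2)]
              shadow_excess_nsets[OF W(1) _ _ subn(2)] 2 3 less.prems W by (simp add: p_def)
        next
          case False
          \<comment> \<open>The only \<open>m\<close>-set in \<open>?W\<close> contains
            \<open>S\<close>, so the deletion is empty and has excess zero.\<close>
          hence mW: "m = card ?W" using less.prems W by linarith
          have "avoiding ?W S m = {}"
            using mW xzW(1) card_subset_eq[OF W(1)] by (auto simp: avoiding_def nsets_iff[OF W(1)])
          hence "excess ?W m (deletion e X) = 0" using sub(2) mW 3(1) by (auto simp: excess_def)
          thus ?thesis using stable.prems split_excess[OF V e(1) n _ stable(1)] 3 p by simp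
        qed
      qed
      thus ?case unfolding q by blast
    qed
  qed
qed

section \<open>Strict growth of the ratio when descending to level \<open>card S\<close>\<close>

lemma twice_choose_two: "2 * int (a choose 2) = int a * (int a - 1)"
  by (induction a) (simp_all add: numeral_2_eq_2 algebra_simps)

text \<open>Here the members of \<open>X\<close> are the sets \<open>V - {v}\<close> with \<open>v\<close> in a subset \<open>P\<close> of \<open>S\<close>, and the
  \<open>card S\<close>-sets outside the shadow are complements of pairs disjoint from \<open>P\<close>. The claim reduces to
  \<open>(p - 1) * (s - p) > 0\<close>.\<close>

lemma shadow_excess_strict_base:
  assumes V: "finite V" "S \<subseteq> V" "2 \<le> card S" "card V = card S + 2"
    and X: "X \<subseteq> avoiding V S (card S + 1)" "0 < excess V (card S + 1) X"
    and less: "excess V (card S + 1) X < excess V (card S + 1) (avoiding V S (card S + 1))"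
  shows "excess V (card S) (avoiding V S (card S)) * excess V (card S + 1) X
    < excess V (card S + 1) (avoiding V S (card S + 1)) * excess V (card S) (shadow X)"
proof -
  define s where "s = card S"
  define P where "P = {v \<in> S. V - {v} \<in> X}"
  define p where "p = card P"
  have cV: "card V = s + 2" using V s_def by simp
  have inj: "inj_on (\<lambda>v. V - {v}) S" using V(2) by (auto simp: inj_on_def)
  have form: "\<exists>v\<in>S. A = V - {v}" if A: "A \<in> avoiding V S (s + 1)" for A
  proof -
    obtain v where v: "v \<in> S" "v \<notin> A" and "A \<subseteq> V" "card A = s + 1"
      using A V(1) by (auto simp: avoiding_def nsets_iff)
    moreover from v V(2) have "card (V - {v}) = s + 1" using cV V(1) by auto
    ultimately have "A = V - {v}" using V(1) by (intro card_subset_eq) auto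
    thus ?thesis using v by blast
  qed
  have "avoiding V S (s + 1) = (\<lambda>v. V - {v}) ` S"
    using form V(1,2) cV by (auto simp: avoiding_def nsets_iff)
  hence ca: "card (avoiding V S (s + 1)) = s" using inj by (simp add: card_image s_def)
  have "X = (\<lambda>v. V - {v}) ` P"
    using form X(1) by (fastforce simp: P_def s_def)
  moreover have "inj_on (\<lambda>v. V - {v}) P" using inj by (rule inj_on_subset) (auto simp: P_def)
  ultimately have cX: "card X = p" by (simp add: card_image p_def)
  have e1: "excess V (s + 1) X = int p - 1" "excess V (s + 1) (avoiding V S (s + 1)) = int s - 1"
    using cX ca cV by (simp_all add: excess_def)
  \<comment> \<open>Positive and non-maximal excess exclude \<open>p <= 1\<close> and
    \<open>p >= s\<close>, which keeps both factors of the final product positive.\<close>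
  have p: "1 < p" "p < s" using X(2) less e1 unfolding s_def[symmetric] by auto
  have S_in: "S \<in> nsets V s" using V(1,2) by (simp add: nsets_iff s_def)
  have "card (avoiding V S s) \<le> card (nsets V s - {S})"
    using V(1) by (intro card_mono) (auto simp: avoiding_def finite_imp_finite_nsets)
  hence "card (avoiding V S s) \<le> (s + 2 choose s) - 1"
    using S_in cV V(1) by (simp add: card_nsets finite_imp_finite_nsets)
  moreover have "0 < (s + 2 choose s)" by simp
  ultimately have "card (avoiding V S s) < (s + 2 choose s)" by linarith
  moreover have sym: "s + 2 choose s = (s + 2 choose 2)" "s + 1 choose s = s + 1"
    using binomial_symmetric[of s "s + 2"] binomial_symmetric[of s "s + 1"] by simp_all
  ultimately have ea: "excess V s (avoiding V S s) \<le> int (s + 2 choose 2) - 1 - (int s + 1)"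
    using cV by (simp add: excess_def)
  have "nsets V s - shadow X \<subseteq> (\<lambda>D. V - D) ` nsets (V - P) 2"
  proof
    fix A assume A: "A \<in> nsets V s - shadow X"
    have A': "A \<subseteq> V" "card A = s" using A V(1) by (auto simp: nsets_iff)
    have c2: "card (V - A) = 2" using A' cV V(1) by (simp add: card_Diff_subset finite_subset)
    have "v \<notin> P" if v: "v \<in> V - A" for v
    proof
      assume "v \<in> P"
      hence vX: "V - {v} \<in> X" by (simp add: P_def)
      have "card (V - A - {v}) = 1" using c2 v V(1) by simp
      then obtain w where w: "V - A - {v} = {w}" by (auto simp: card_1_singleton_iff)
      hence "A = (V - {v}) - {w}" "w \<in> V - {v}" using A' v by auto
      thus False using vX A by (auto simp: shadow_def)
    qed
    hence "V - A \<in> nsets (V - P) 2" using c2 V(1) by (auto simp: nsets_iff)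
    moreover have "A = V - (V - A)" using A' by auto
    ultimately show "A \<in> (\<lambda>D. V - D) ` nsets (V - P) 2" by blast
  qed
  hence "card (nsets V s - shadow X) \<le> card (nsets (V - P) 2)"
    by (rule surj_card_le[rotated]) (use V(1) finite_imp_finite_nsets in auto)
  also have "\<dots> = (s + 2 - p choose 2)"
  proof -
    have "P \<subseteq> V" using V(2) by (auto simp: P_def)
    thus ?thesis using V(1) cV by (simp add: card_nsets card_Diff_subset finite_subset p_def)
  qed
  finally have "card (nsets V s) \<le> (s + 2 - p choose 2) + card (shadow X)"
    using diff_card_le_card_Diff[OF finite_shadow[OF V(1) X(1)[THEN subset_trans[OF _ avoiding_subset]]], of "nsets V s"] by linarith
  hence es: "int (s + 2 choose 2) - int (s + 2 - p choose 2) - (int s + 1) \<le> excess V s (shadow X)"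
    using V(1) cV sym by (simp add: card_nsets excess_def)
  \<comment> \<open>Doubling the binomials turns the claim into a polynomial identity whose right
    side is \<open>(s - 1) * (p - 1) * (s - p)\<close>.\<close>
  define a b where "a = int (s + 2 choose 2)" and "b = int (s + 2 - p choose 2)"
  have "2 * a = (int s + 2) * (int s + 1)" "2 * b = (int s + 2 - int p) * (int s + 1 - int p)"
    unfolding a_def b_def twice_choose_two using p by (simp_all add: of_nat_diff algebra_simps)
  hence "2 * ((int s - 1) * (a - b - (int s + 1)) - (a - 1 - (int s + 1)) * (int p - 1))
    = (int s - 1) * ((int p - 1) * (int s - int p))"
    by algebra
  also have "\<dots> > 0" using p by simp
  finally have "(a - 1 - (int s + 1)) * (int p - 1) < (int s - 1) * (a - b - (int s + 1))" by simp
  moreover have "excess V s (avoiding V S s) * (int p - 1) \<le> (a - 1 - (int s + 1)) * (int p - 1)"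
    using ea p unfolding a_def by (intro mult_right_mono) auto
  moreover have "(int s - 1) * (a - b - (int s + 1)) \<le> (int s - 1) * excess V s (shadow X)"
    using es p unfolding a_def b_def by (intro mult_left_mono) auto
  ultimately show ?thesis unfolding s_def[symmetric] e1 by linarith
qed

text \<open>Induction on \<open>card V\<close> from the base \<open>card V = card S + 2\<close>. The
  mediant step is strict once deletion and link are compared strictly. If the excess of the deletion
  is at most zero, signs give this; if it lies strictly between zero and its maximum, the induction
  hypothesis does; if it is maximal, equality would make the excess of the link and hence of
  \<open>X\<close> maximal, contrary to the assumption.\<close>

lemma shadow_excess_strict:
  assumes "finite V" "S \<subseteq> V" "2 \<le> card S" "card S + 2 \<le> card V"
    and "X \<subseteq> avoiding V S (card S + 1)" "0 < excess V (card S + 1) X"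
    and "excess V (card S + 1) X < excess V (card S + 1) (avoiding V S (card S + 1))"
  shows "excess V (card S) (avoiding V S (card S)) * excess V (card S + 1) X
    < excess V (card S + 1) (avoiding V S (card S + 1)) * excess V (card S) (shadow X)"
  using assms
proof (induction "card V" arbitrary: V X rule: less_induct)
  case less
  define s where "s = card S"
  note V = \<open>finite V\<close>
  obtain x z where "x \<in> S" "z \<in> S" "x \<noteq> z"
    using less.prems(3) card_2_iff' obtain_subset_with_card_n[of 2 S] by (metis subsetD)
  hence xz: "x \<in> S" "x \<in> V" "z \<in> S" "z \<in> V" "x \<noteq> z" using less.prems by auto
  have n: "2 \<le> card V" using less.prems by auto
  have X: "X \<subseteq> nsets V (s + 1)" using less.prems avoiding_subset unfolding s_def by blast
  show ?case unfolding s_def[symmetric]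
  proof (cases "card V = s + 2")
    case True
    show "excess V s (avoiding V S s) * excess V (s + 1) X
      < excess V (s + 1) (avoiding V S (s + 1)) * excess V s (shadow X)"
      using shadow_excess_strict_base less.prems True unfolding s_def by blast
  next
    case False
    hence sn: "s + 2 < card V" using less.prems s_def by simp
    have "S \<noteq> V" using sn s_def by auto
    then obtain e where e: "e \<in> V" "e \<notin> S" using less.prems by blast
    let ?W = "V - {e}"
    have W: "finite ?W" "card ?W < card V" "card ?W = card V - 1" using V e n by auto
    have xzW: "S \<subseteq> ?W" "x \<in> ?W" "z \<in> ?W" using xz e less.prems by auto
    define p where "p j = excess ?W j (avoiding ?W S j)" for j
    have q: "excess V (s + 1) (avoiding V S (s + 1)) = p (s + 1) + p s"
      "excess V s (avoiding V S s) = p s + p (s - 1)"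
      using split_excess[OF V e(1) n _ avoiding_subset] e V less.prems
      by (auto simp: link_avoiding deletion_avoiding p_def s_def)
    have p: "0 < p s" "0 < p (s + 1)" "0 < p (s - 1)"
      unfolding p_def using W less.prems xz xzW sn s_def
      by (auto intro!: excess_avoiding_pos[of _ x _ z])
    have "excess V s (avoiding V S s) * excess V (s + 1) X
      < excess V (s + 1) (avoiding V S (s + 1)) * excess V s (shadow X)"
      using V e(1) X less.prems(5,6,7) unfolding s_def[symmetric]
    proof (induction rule: shift_induct)
      case (shift X j)
      let ?Y = "shift e j X"
      note ex = excess_shift[OF V shift(1) e(1) shift(2,3)]
      have "excess V (s + 1) (avoiding V S (s + 1)) * excess V s (shadow ?Y)
          \<le> excess V (s + 1) (avoiding V S (s + 1)) * excess V s (shadow X)"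
        using ex V xz by (intro mult_left_mono excess_avoiding_nonneg) auto
      moreover have "excess V s (avoiding V S s) * excess V (s + 1) ?Y
          < excess V (s + 1) (avoiding V S (s + 1)) * excess V s (shadow ?Y)"
        using shift.prems ex(1) by (intro shift.IH shift_avoids[OF V _ e(1) shift(2) e(2)]) auto
      ultimately show ?case using ex(1) by simp
    next
      case (stable X)
      let ?y1 = "excess ?W s (link e X)" and ?y0 = "excess ?W (s + 1) (deletion e X)"
      let ?z = "excess ?W (s - 1) (shadow (link e X))" and ?d0 = "excess ?W s (shadow (deletion e X))"
      have sub: "link e X \<subseteq> avoiding ?W S s" "deletion e X \<subseteq> avoiding ?W S (s + 1)"
        using link_avoids[OF stable(3) V e(1) _ e(2)] deletion_avoids[OF stable(3)] by simp_all
      note subn = sub[THEN subset_trans[OF _ avoiding_subset]]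
      have sum: "excess V (s + 1) X = ?y1 + ?y0" using split_excess[OF V e(1) n _ stable(1)] by simp
      have d0: "?d0 \<le> ?y1"
        using card_mono[OF _ stable_shadow_deletion[OF V stable(1,2)]]
          finite_subfamily[OF _ link_subset[OF V stable(1)]] V by (simp add: excess_def)
      have y1: "?y1 \<le> p s" and y0: "?y0 \<le> p (s + 1)"
        unfolding p_def using sub W by (auto intro!: excess_mono[OF _ _ avoiding_subset])
      have y: "0 \<le> ?y1 \<and> p s * ?y0 < p (s + 1) * ?y1"
      proof (cases "?y0 \<le> 0")
        case True
        hence "p s * ?y0 \<le> 0" "0 < ?y1" using p stable.prems sum by (auto simp: mult_le_0_iff)
        moreover from this have "0 < p (s + 1) * ?y1" using p by simp
        ultimately show ?thesis by linarith
      next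
        case False
        have free: "0 \<le> ?d0" using shadow_excess_nsets[OF W(1) _ _ subn(2)] False sn W by simp
        have le: "p (s + 1) * ?d0 \<le> p (s + 1) * ?y1"
          using d0 p by (intro mult_left_mono) auto
        show ?thesis
        proof (cases "?y0 = p (s + 1)")
          case True
          have "p s * ?y0 \<le> p (s + 1) * ?d0"
            using shadow_excess_avoiding[OF W(1) xzW(1) xz(1,3,5) _ _ sub(2)] False sn W p_def by simp
          moreover have "p s * ?y0 \<noteq> p (s + 1) * ?y1"
            using True stable.prems(3) sum q p y1 by auto
          ultimately show ?thesis using le free d0 by linarith
        next
          case False2: False
          have "p s * ?y0 < p (s + 1) * ?d0"
            using less.hyps[OF W(2,1) xzW(1) less.prems(3)] sub(2) y0 False False2 sn W
            unfolding s_def[symmetric] p_def by simp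
          thus ?thesis using le free d0 by linarith
        qed
      qed
      have z: "p (s - 1) * ?y1 \<le> p s * ?z"
        using shadow_excess_avoiding[OF W(1) xzW(1) xz(1,3,5) _ _ sub(1)] y sn W p_def less.prems s_def by simp
      have d: "?y1 + ?z \<le> excess V s (shadow X)"
        using stable_excess[OF V e(1) n _ stable(1)] less.prems(3) s_def by simp
      show ?case using weighted_step(2)[OF d z p(1), of "p (s + 1)" ?y0] y p sum q by simp
    qed
    thus "excess V s (avoiding V S s) * excess V (s + 1) X
      < excess V (s + 1) (avoiding V S (s + 1)) * excess V s (shadow X)" .
  qed
qed

section \<open>Uniqueness for shadows of minimal size\<close>

text \<open>Double counting of pairs of a member and one of its points: deleting the point injects
  them into pairs of a shadow member and a point outside it. Equality makes this injection onto, so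
  a member may exchange any of its points for any other point of \<open>W\<close>, and such
  exchanges reach all \<open>p\<close>-sets.\<close>

lemma local_lym:
  assumes W: "finite W" "1 \<le> p" "p \<le> card W" and Y: "Y \<subseteq> nsets W p"
  shows "card Y * (card W choose (p - 1)) \<le> card (shadow Y) * (card W choose p)"
    and "card Y * (card W choose (p - 1)) = card (shadow Y) * (card W choose p) \<Longrightarrow> Y = {} \<or> Y = nsets W p"
proof -
  define w where "w = card W"
  define E where "E = (SIGMA A:Y. A)"
  define E' where "E' = (SIGMA B:shadow Y. W - B)"
  define f where "f = (\<lambda>(A, a). (A - {a}, a :: 'a))"
  have fin: "finite Y" "finite (shadow Y)" using finite_subfamily finite_shadow W Y by blast+
  have Y': "A \<subseteq> W" "finite A" "card A = p" if "A \<in> Y" for A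
    using that Y W(1) by (auto simp: nsets_def)
  have sY: "B \<subseteq> W" "finite B" "card B = p - 1" if "B \<in> shadow Y" for B
    using that shadow_subset[OF W(1) Y] by (auto simp: nsets_def)
  have cE: "card E = card Y * p" using fin Y' by (simp add: E_def)
  have cE': "card E' = card (shadow Y) * (w - (p - 1))"
    using fin sY W by (simp add: E'_def card_Diff_subset w_def)
  have fE: "f ` E \<subseteq> E'" using Y' by (force simp: f_def E_def E'_def shadow_def)
  have inj: "inj_on f E" by (auto simp: inj_on_def f_def E_def)
  have finE': "finite E'" using fin W by (auto simp: E'_def)
  have le: "card Y * p \<le> card (shadow Y) * (w - (p - 1))"
    using card_inj_on_le[OF inj fE finE'] cE cE' by simp
  \<comment> \<open>Absorption converts the ratio of \<open>p\<close> to \<open>w - (p - 1)\<close>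
    from the count into the ratio of the two binomials.\<close>
  have "Suc (p - 1) * (w choose Suc (p - 1)) = (w - (p - 1)) * (w choose (p - 1))"
    using binomial_absorption[of "p - 1" w] binomial_absorb_comp[of w "p - 1"] by simp
  hence ab: "p * (w choose p) = (w - (p - 1)) * (w choose (p - 1))" using W(2) by simp
  have pos: "0 < w - (p - 1)" "0 < (w choose p)" using W by (auto simp: w_def)
  have l: "(w - (p - 1)) * (card Y * (w choose (p - 1))) = card Y * p * (w choose p)"
    using ab by (simp add: ac_simps)
  have r: "(w - (p - 1)) * (card (shadow Y) * (w choose p)) = card (shadow Y) * (w - (p - 1)) * (w choose p)"
    by (simp add: ac_simps)
  have "(w - (p - 1)) * (card Y * (w choose (p - 1))) \<le> (w - (p - 1)) * (card (shadow Y) * (w choose p))"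
    unfolding l r using le by (rule mult_le_mono1)
  thus "card Y * (card W choose (p - 1)) \<le> card (shadow Y) * (card W choose p)"
    using pos w_def by simp
  assume "card Y * (card W choose (p - 1)) = card (shadow Y) * (card W choose p)"
  hence "card Y * p * (w choose p) = card (shadow Y) * (w - (p - 1)) * (w choose p)"
    using l r w_def by metis
  hence "card Y * p = card (shadow Y) * (w - (p - 1))" using pos(2) by simp
  hence "card (f ` E) = card E'" using cE cE' card_image[OF inj] by simp
  hence eq: "f ` E = E'" using card_subset_eq[OF finE' fE] by simp
  have exch: "insert c (A - {a}) \<in> Y" if A: "A \<in> Y" "a \<in> A" "c \<in> W" "c \<notin> A" for A a c
  proof -
    have "(A - {a}, c) \<in> E'" using A by (auto simp: E'_def shadow_def)
    then obtain A' b where "(A', b) \<in> E" "f (A', b) = (A - {a}, c)" using eq by force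
    hence "A' \<in> Y" "c \<in> A'" "A' - {c} = A - {a}" by (auto simp: E_def f_def)
    thus ?thesis by (metis insert_Diff)
  qed
  \<comment> \<open>Each exchange brings \<open>A\<close> one point closer to
    \<open>C\<close>.\<close>
  have all: "C \<in> Y" if "A \<in> Y" "C \<in> nsets W p" for A C
    using that
  proof (induction "card (C - A)" arbitrary: A)
    case 0
    have C: "finite C" "card C = p" using 0 W(1) by (auto simp: nsets_def)
    hence "C \<subseteq> A" using 0 by simp
    hence "C = A" using C Y'[OF 0(2)] by (intro card_subset_eq) auto
    thus ?case using 0 by simp
  next
    case (Suc k)
    have C: "finite C" "card C = p" "C \<subseteq> W" using Suc.prems W(1) by (auto simp: nsets_def)
    have "C - A \<noteq> {}" using Suc.hyps(2) by (metis card.empty nat.distinct(1))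
    then obtain c where c: "c \<in> C" "c \<notin> A" by blast
    have "\<not> A \<subseteq> C" using c C Y'[OF Suc.prems(1)] card_subset_eq[of C A] by auto
    then obtain a where a: "a \<in> A" "a \<notin> C" by blast
    have "C - insert c (A - {a}) = C - A - {c}" using a by auto
    hence "card (C - insert c (A - {a})) = k" using Suc.hyps(2) c C by simp
    thus ?case using Suc.hyps(1)[of "insert c (A - {a})"] exch[of A a c] Suc.prems a c C by auto
  qed
  show "Y = {} \<or> Y = nsets W p" using all Y by blast
qed

lemma nsets_Diff_eqI:
  assumes "finite V" "x \<in> V" "X \<subseteq> nsets V m" "card X = card V - 1 choose m" "\<And>A. A \<in> X \<Longrightarrow> x \<notin> A"
  shows "X = nsets (V - {x}) m"
proof (rule card_subset_eq)
  show "X \<subseteq> nsets (V - {x}) m" using assms(3,5) by (auto simp: nsets_def)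
qed (use assms in \<open>auto simp: card_nsets finite_imp_finite_nsets\<close>)

text \<open>The only nontrivial case is \<open>x = j\<close>: there the two links of \<open>X\<close> at \<open>e\<close> and \<open>j\<close>, restricted to
  \<open>V - {e, j}\<close>, partition all \<open>(m - 1)\<close>-sets, and minimality of the shadow forces equality in the
  local LYM inequality for both, so one of them is empty.\<close>

lemma unshift_star:
  assumes V: "finite V" "e \<in> V" "j \<in> V" "e \<noteq> j" and m: "2 \<le> m" "m < card V" and X: "X \<subseteq> nsets V m"
    and sX: "card (shadow X) \<le> card V - 1 choose (m - 1)"
    and x: "x \<in> V" "shift e j X = nsets (V - {x}) m"
  shows "\<exists>y\<in>V. X = nsets (V - {y}) m"
proof -
  have fin: "finite X" "finite (shadow X)" using finite_subfamily finite_shadow V X by blast+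
  have cX: "card X = card V - 1 choose m"
    using card_shift[OF fin(1) V(4)] x V by (simp add: card_nsets)
  have shift_x: "x \<notin> A" if "A \<in> shift e j X" for A using that x(2) by (auto simp: nsets_def)
  have "\<exists>y\<in>{x, e}. \<forall>A\<in>X. y \<notin> A"
  proof (cases "x = j")
    case False
    have "x \<notin> A" if A: "A \<in> X" for A
    proof (cases "A \<in> shift e j X")
      case False2: False
      \<comment> \<open>A member lost in the shift contains \<open>j\<close> but not
        \<open>e\<close>, and its exchanged set belongs to the shifted family. That set misses
        \<open>x\<close>, and since \<open>x\<close> is not \<open>j\<close>, so does
        \<open>A\<close>.\<close>
      hence jA: "j \<in> A" "e \<notin> A" using A by (auto simp: shift_def split: if_splits)
      hence "insert j (insert e (A - {j}) - {e}) = A" by auto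
      hence "insert e (A - {j}) \<in> shift e j X" using A jA V(4) by (simp add: shift_def)
      thus ?thesis using shift_x[of "insert e (A - {j})"] False by auto
    qed (use shift_x in blast)
    thus ?thesis by blast
  next
    case True
    let ?W = "V - {e, j}"
    have W: "finite ?W" "card ?W = card V - 2" using V by (auto simp: card_Diff_subset)
    define Y where "Y a = {B \<in> nsets ?W (m - 1). insert a B \<in> X}" for a
    have YW: "Y a \<subseteq> nsets ?W (m - 1)" for a by (auto simp: Y_def)
    note finY = finite_subfamily[OF W(1) YW] finite_shadow[OF W(1) YW]
    have both: "insert e B \<in> X \<or> insert j B \<in> X" "insert e B \<notin> X \<or> insert j B \<notin> X"
      if B: "B \<in> nsets ?W (m - 1)" for B
    proof -
      have eB: "e \<notin> B" "j \<notin> B" "B \<subseteq> V" "finite B" "card B = m - 1" using B by (auto simp: nsets_def)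
      hence "insert e B \<in> nsets (V - {x}) m" using V m True by (auto simp: nsets_def)
      hence "insert e B \<in> shift e j X" using x by simp
      thus "insert e B \<in> X \<or> insert j B \<in> X" using eB V(4) by (auto simp: shift_def)
      have "insert j B \<notin> shift e j X" using shift_x True by blast
      thus "insert e B \<notin> X \<or> insert j B \<notin> X" using eB V(4) by (auto simp: shift_def)
    qed
    have un: "Y e \<union> Y j = nsets ?W (m - 1)" "Y e \<inter> Y j = {}" using both by (auto simp: Y_def)
    have cY: "card (Y e) + card (Y j) = card V - 2 choose (m - 1)"
      using card_Un_disjoint[OF finY(1) finY(1) un(2)] un(1) W by (simp add: card_nsets)
    have nin: "e \<notin> B \<and> j \<notin> B" if "B \<in> shadow (Y a) \<or> B \<in> nsets ?W (m - 1)" for a B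
      using that by (auto simp: shadow_def Y_def nsets_def)
    have ins: "insert a ` shadow (Y a) \<subseteq> shadow X" if "a \<in> {e, j}" for a
    proof
      fix C assume "C \<in> insert a ` shadow (Y a)"
      then obtain B b where B: "B \<in> Y a" "b \<in> B" "C = insert a (B - {b})" by (auto simp: shadow_def)
      hence "C = insert a B - {b}" "insert a B \<in> X" "b \<in> insert a B"
        using that by (auto simp: Y_def nsets_def)
      thus "C \<in> shadow X" unfolding shadow_def by blast
    qed
    have "nsets ?W (m - 1) \<subseteq> shadow X"
    proof
      fix B assume B: "B \<in> nsets ?W (m - 1)"
      then obtain a where "a \<in> {e, j}" "insert a B \<in> X" using both(1) by blast
      moreover from this have "B = insert a B - {a}" using B by (auto simp: nsets_def)
      ultimately show "B \<in> shadow X" unfolding shadow_def by blast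
    qed
    \<comment> \<open>These are three disjoint parts of the shadow: sets with neither
      \<open>e\<close> nor \<open>j\<close>, with \<open>e\<close> only, and with \<open>j\<close>
      only. The first part is complete, which leaves at most
      \<open>card V - 2 choose (m - 2)\<close> sets for the other two.\<close>
    hence "nsets ?W (m - 1) \<union> (insert e ` shadow (Y e) \<union> insert j ` shadow (Y j)) \<subseteq> shadow X"
      using ins by auto
    hence "card (nsets ?W (m - 1) \<union> (insert e ` shadow (Y e) \<union> insert j ` shadow (Y j))) \<le> card (shadow X)"
      using fin(2) by (rule card_mono[rotated])
    also have "card (nsets ?W (m - 1) \<union> (insert e ` shadow (Y e) \<union> insert j ` shadow (Y j)))
      = card (nsets ?W (m - 1)) + (card (insert e ` shadow (Y e)) + card (insert j ` shadow (Y j)))"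
    proof (subst card_Un_disjoint)
      show "nsets ?W (m - 1) \<inter> (insert e ` shadow (Y e) \<union> insert j ` shadow (Y j)) = {}"
        by (auto simp: nsets_def)
      have "insert e ` shadow (Y e) \<inter> insert j ` shadow (Y j) = {}" using nin V(4) by blast
      thus "card (nsets ?W (m - 1)) + card (insert e ` shadow (Y e) \<union> insert j ` shadow (Y j))
        = card (nsets ?W (m - 1)) + (card (insert e ` shadow (Y e)) + card (insert j ` shadow (Y j)))"
        using finY(2) by (subst card_Un_disjoint) auto
    qed (use finY(2) finite_imp_finite_nsets[OF W(1)] in auto)
    also have "card (insert e ` shadow (Y e)) = card (shadow (Y e))"
      by (rule card_image) (meson inj_onI insert_ident nin)
    also have "card (insert j ` shadow (Y j)) = card (shadow (Y j))"
      by (rule card_image) (meson inj_onI insert_ident nin)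
    finally have "(card V - 2 choose (m - 1)) + (card (shadow (Y e)) + card (shadow (Y j))) \<le> card V - 1 choose (m - 1)"
      using sX W by (simp add: card_nsets)
    also have "card V - 1 choose (m - 1) = (card V - 2 choose (m - 2)) + (card V - 2 choose (m - 1))"
      using m choose_reduce_nat[of "card V - 1" "m - 1"] by (simp add: numeral_2_eq_2)
    finally have sle: "card (shadow (Y e)) + card (shadow (Y j)) \<le> card V - 2 choose (m - 1 - 1)"
      by (simp add: numeral_2_eq_2)
    have m1: "1 \<le> m - 1" "m - 1 \<le> card ?W" using m W by auto
    let ?c1 = "card ?W choose (m - 1)" and ?c2 = "card ?W choose (m - 1 - 1)"
    note lym = local_lym[OF W(1) m1 YW]
    \<comment> \<open>The upper bound for the two shadows together meets the sum of the two LYM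
      inequalities, so each of these is an equality.\<close>
    have "(card (shadow (Y e)) + card (shadow (Y j))) * ?c1 \<le> ?c2 * ?c1"
      using sle W by (intro mult_le_mono1) simp
    also have "\<dots> = card (Y e) * ?c2 + card (Y j) * ?c2"
      using cY W by (simp flip: add_mult_distrib)
    finally have "card (Y e) * ?c2 = card (shadow (Y e)) * ?c1"
      using lym(1)[of e] lym(1)[of j] by (simp add: add_mult_distrib)
    hence "Y e = {} \<or> Y e = nsets ?W (m - 1)" by (rule lym(2))
    hence "Y e = {} \<or> Y j = {}" using un by blast
    \<comment> \<open>The shift does not touch sets containing both points, and all shifted sets
      miss \<open>j\<close>.\<close>
    moreover have notboth: "e \<notin> A \<or> j \<notin> A" if A: "A \<in> X" for A
      using A shift_x[of A] True by (auto simp: shift_def)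
    moreover have YI: "A - {a} \<in> Y a" if A: "A \<in> X" "a \<in> A" "a \<in> {e, j}" for A a
    proof -
      have "insert a (A - {a}) = A" using A by auto
      thus ?thesis using A X V notboth[OF A(1)] by (auto simp: Y_def nsets_def)
    qed
    ultimately have "(\<forall>A\<in>X. e \<notin> A) \<or> (\<forall>A\<in>X. j \<notin> A)" by blast
    thus ?thesis using True by blast
  qed
  then obtain y where "y \<in> V" "\<forall>A\<in>X. y \<notin> A" using V x by blast
  thus ?thesis using nsets_Diff_eqI[OF V(1) _ X cX] by blast
qed

text \<open>For a stable family the excesses of the link and of its shadow are nonnegative and add
  up to at most zero. So both vanish, and the induction hypothesis gives a point \<open>x\<close>
  missed by the link; stability extends this to the deletion. Other families are reached by undoing
  shifts with \<open>unshift_star\<close>.\<close>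

lemma shadow_star:
  assumes "finite V" "2 \<le> m" "m < card V" "X \<subseteq> nsets V m"
    and "excess V m X = 0" "excess V (m - 1) (shadow X) \<le> 0"
  shows "\<exists>x\<in>V. X = nsets (V - {x}) m"
  using assms
proof (induction "card V" arbitrary: V m X rule: less_induct)
  case less
  note V = \<open>finite V\<close>
  have n: "2 \<le> card V" using less.prems by auto
  show ?case
  proof (cases "m = 2")
    case True
    have X2: "A \<subseteq> V" "card A = 2" if "A \<in> X" for A
      using that less.prems(4) True by (auto simp: nsets_def)
    \<comment> \<open>Level \<open>2\<close> is the base because the recursion applies to the link,
      one level lower. Every covered point gives a singleton in the shadow, and fewer than
      \<open>card V\<close> singletons leave some point uncovered.\<close>
    have "(\<lambda>v. {v}) ` (\<Union>X) \<subseteq> shadow X"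
    proof clarify
      fix v A assume A: "v \<in> A" "A \<in> X"
      obtain a b where ab: "A = {a, b}" "a \<noteq> b" using X2[OF A(2)] by (auto simp: card_2_iff)
      then obtain c where "A - {c} = {v}" "c \<in> A" using A(1) by auto
      thus "{v} \<in> shadow X" using A(2) unfolding shadow_def by (metis (mono_tags, lifting) mem_Collect_eq)
    qed
    hence "card ((\<lambda>v. {v}) ` (\<Union>X)) \<le> card (shadow X)"
      using finite_shadow[OF V less.prems(4)] by (rule card_mono[rotated])
    moreover have "card ((\<lambda>v. {v}) ` (\<Union>X)) = card (\<Union>X)" by (rule card_image) auto
    ultimately have "card (\<Union>X) < card V" using less.prems True by (simp add: excess_def)
    hence "\<Union>X \<noteq> V" by auto
    then obtain x where "x \<in> V" "\<And>A. A \<in> X \<Longrightarrow> x \<notin> A" using X2 by blast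
    thus ?thesis using nsets_Diff_eqI[OF V _ less.prems(4)] less.prems(5) by (auto simp: excess_def)
  next
    case False
    obtain e where e: "e \<in> V" using n by fastforce
    let ?W = "V - {e}"
    have W: "finite ?W" "card ?W < card V" "card ?W = card V - 1" using V e n by auto
    show ?thesis using V e less.prems(4,5,6)
    proof (induction rule: shift_induct)
      case (shift X j)
      note ex = excess_shift[OF V shift(1) e shift(2,3)]
      obtain x where "x \<in> V" "shift e j X = nsets (V - {x}) m"
        using shift.IH shift.prems ex by force
      thus ?case using unshift_star[OF V e shift(2,3) less.prems(2,3) shift(1)] shift.prems
        by (simp add: excess_def)
    next
      case (stable X)
      let ?y1 = "excess ?W (m - 1) (link e X)" and ?y0 = "excess ?W m (deletion e X)"
      let ?z = "excess ?W (m - 2) (shadow (link e X))"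
      have sub: "link e X \<subseteq> nsets ?W (m - 1)" "deletion e X \<subseteq> nsets ?W m"
        using link_subset deletion_subset V stable by metis+
      have sum: "?y1 + ?y0 = 0"
        using split_excess[OF V e n _ stable(1)] less.prems(2) stable.prems by simp
      have y1: "0 \<le> ?y1"
      proof (cases "0 \<le> ?y0 \<and> m < card ?W")
        case True
        hence "0 \<le> excess ?W (m - 1) (shadow (deletion e X))"
          using shadow_excess_nsets[OF W(1) _ _ sub(2)] less.prems(2) by simp
        also have "\<dots> \<le> ?y1" using stable_shadow_deletion[OF V stable(1,2)] sub(1)
          by (rule excess_mono[OF W(1)])
        finally show ?thesis .
      next
        case False
        show ?thesis
        proof (cases "0 \<le> ?y0")
          case True
          hence mW: "m = card ?W" using False less.prems W by linarith
          hence "deletion e X = {} \<or> deletion e X = {?W}"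
            using sub(2) nsets_card_self[OF W(1)] by auto
          thus ?thesis
          proof
            assume "deletion e X = {}"
            thus ?thesis using mW sum less.prems(2) by (simp add: excess_def)
          next
            assume "deletion e X = {?W}"
            hence "link e X = nsets ?W (m - 1)"
              using stable_link_top[OF V stable(1,2)] mW less.prems(2) by simp
            thus ?thesis using excess_nsets_nonneg[OF W(1)] by simp
          qed
        qed (use sum in simp)
      qed
      have z: "0 \<le> ?z" using shadow_excess_nsets[OF W(1) _ _ sub(1) y1] less.prems W by (simp add: numeral_2_eq_2)
      have "?y1 + ?z \<le> excess V (m - 1) (shadow X)" by (rule stable_excess[OF V e n less.prems(2) stable(1)])
      hence "?y1 = 0" "?z = 0" using y1 z stable.prems by auto
      moreover have "2 \<le> m - 1" "m - 1 < card ?W" "m - 1 - 1 = m - 2" using less.prems False W by auto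
      ultimately obtain x where x: "x \<in> ?W" "link e X = nsets (?W - {x}) (m - 1)"
        using less.hyps[OF W(2,1) _ _ sub(1)] by auto
      have "x \<notin> A" if A: "A \<in> X" for A
      proof
        assume xA: "x \<in> A"
        show False
        proof (cases "e \<in> A")
          case True
          hence "A - {e} \<in> link e X" using A by (auto simp: link_def insert_absorb)
          thus False using x xA by (auto simp: nsets_def)
        next
          case False2: False
          \<comment> \<open>Deleting from \<open>A\<close> a point other than \<open>x\<close> gives
            a member of the link that still contains \<open>x\<close>.\<close>
          have "card A = m" using A stable(1) by (auto simp: nsets_def)
          hence "A \<noteq> {x}" using less.prems(2) by auto
          then obtain a where "a \<in> A" "a \<noteq> x" using xA by blast
          moreover from this have "A - {a} \<in> shadow (deletion e X)"
            using A False2 by (auto simp: shadow_def deletion_def)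
          ultimately show False
            using stable_shadow_deletion[OF V stable(1,2)] x xA by (auto simp: nsets_def)
        qed
      qed
      moreover have "card X = card V - 1 choose m" using stable.prems by (simp add: excess_def)
      ultimately show ?case using nsets_Diff_eqI[OF V _ stable(1)] x(1) by blast
    qed
  qed
qed

section \<open>Iterated shadows\<close>

text \<open>The iterated shadow, described in one go. The condition \<open>finite A\<close> keeps
  out infinite \<open>B\<close>, for which \<open>card\<close> has the default value
  \<open>0\<close>.\<close>

definition lower :: "'a set set \<Rightarrow> nat \<Rightarrow> 'a set set" where
  "lower X l = {B. card B = l \<and> (\<exists>A\<in>X. finite A \<and> B \<subseteq> A)}"

lemma lower_self:
  assumes "X \<subseteq> nsets V m"
  shows "lower X m = X"
proof (intro equalityI subsetI)
  fix B assume "B \<in> lower X m"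
  then obtain A where A: "A \<in> X" "finite A" "B \<subseteq> A" "card B = m" by (auto simp: lower_def)
  moreover from this assms have "card A = m" by (auto simp: nsets_def)
  ultimately show "B \<in> X" using card_subset_eq[of A B] by simp
qed (use assms in \<open>auto simp: lower_def nsets_def\<close>)

lemma lower_subset: "X \<subseteq> nsets V m \<Longrightarrow> lower X l \<subseteq> nsets V l"
  by (auto simp: lower_def nsets_def intro: finite_subset)

lemma lower_avoiding:
  assumes "X \<subseteq> avoiding V S m"
  shows "lower X l \<subseteq> avoiding V S l"
proof
  fix B assume B: "B \<in> lower X l"
  have "X \<subseteq> nsets V m" using assms avoiding_subset by blast
  hence "B \<in> nsets V l" using lower_subset B by blast
  moreover obtain A where "A \<in> X" "B \<subseteq> A" using B by (auto simp: lower_def)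
  hence "\<not> S \<subseteq> B" using assms by (auto simp: avoiding_def)
  ultimately show "B \<in> avoiding V S l" by (simp add: avoiding_def)
qed

lemma lower_lower:
  assumes "l \<le> j" "j \<le> m" "X \<subseteq> nsets V m"
  shows "lower (lower X j) l = lower X l"
proof
  show "lower (lower X j) l \<subseteq> lower X l" by (auto simp: lower_def)
  show "lower X l \<subseteq> lower (lower X j) l"
  proof
    fix B assume "B \<in> lower X l"
    then obtain A where A: "card B = l" "A \<in> X" "finite A" "B \<subseteq> A" by (auto simp: lower_def)
    hence "card A = m" using assms by (auto simp: nsets_def)
    then obtain C where "B \<subseteq> C" "C \<subseteq> A" "card C = j"
      using exists_subset_between[of B j A] A assms by auto
    thus "B \<in> lower (lower X j) l" using A by (auto simp: lower_def intro: finite_subset)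
  qed
qed

lemma shadow_eq_lower:
  assumes "X \<subseteq> nsets V m" "1 \<le> m"
  shows "shadow X = lower X (m - 1)"
proof
  show "shadow X \<subseteq> lower X (m - 1)" using assms by (fastforce simp: shadow_def lower_def nsets_def)
  show "lower X (m - 1) \<subseteq> shadow X"
  proof
    fix B assume "B \<in> lower X (m - 1)"
    then obtain A where A: "card B = m - 1" "A \<in> X" "finite A" "B \<subseteq> A" by (auto simp: lower_def)
    hence "card A = m" using assms by (auto simp: nsets_def)
    hence "card (A - B) = 1" using A assms(2) by (simp add: card_Diff_subset finite_subset)
    then obtain a where "A - B = {a}" by (auto simp: card_1_singleton_iff)
    hence "B = A - {a}" "a \<in> A" using A by auto
    thus "B \<in> shadow X" using A unfolding shadow_def by blast
  qed
qed

lemma shadow_lower: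
  assumes "Suc l \<le> m" "X \<subseteq> nsets V m"
  shows "shadow (lower X (Suc l)) = lower X l"
  using shadow_eq_lower[OF lower_subset[OF assms(2)]] lower_lower[OF _ assms] by simp

text \<open>Transitivity of \<open>x / a <= y / b <= z / c\<close> with denominators cleared, so
  that \<open>a\<close> and \<open>c\<close> may vanish. It composes the one-level estimates along
  the descent.\<close>

lemma chain_ratio:
  fixes a b c x y z :: int
  assumes "b * x \<le> a * y" "c * y \<le> b * z" "0 < b" "0 \<le> a" "0 \<le> c"
  shows "c * x \<le> a * z"
proof -
  have "b * (c * x) \<le> c * (a * y)" using mult_left_mono[OF assms(1,5)] by (simp add: ac_simps)
  also have "\<dots> \<le> b * (a * z)" using mult_left_mono[OF assms(2,4)] by (simp add: ac_simps)
  finally show ?thesis using assms(3) by simp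
qed

lemma lower_excess_nsets:
  assumes "finite V" "1 \<le> l" "l \<le> m" "m < card V" "X \<subseteq> nsets V m" "0 \<le> excess V m X"
  shows "0 \<le> excess V l (lower X l) \<and>
    excess V l (nsets V l) * excess V m X \<le> excess V m (nsets V m) * excess V l (lower X l)"
  using assms(3,2)
proof (induction rule: inc_induct)
  case base
  thus ?case using assms lower_self[OF assms(5)] by simp
next
  case (step l)
  have "0 \<le> excess V l (lower X l) \<and> excess V l (nsets V l) * excess V (Suc l) (lower X (Suc l))
    \<le> excess V (Suc l) (nsets V (Suc l)) * excess V l (lower X l)"
    using shadow_excess_nsets[OF assms(1) _ _ lower_subset[OF assms(5)], of "Suc l"] step assms(4)
      shadow_lower[OF _ assms(5), of l] by simp
  thus ?case
    using chain_ratio[of "excess V (Suc l) (nsets V (Suc l))"] step assms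
      excess_nsets_pos[of "Suc l" V] excess_nsets_nonneg[OF assms(1)] by auto
qed

lemma lower_excess_avoiding:
  assumes "finite V" "S \<subseteq> V" "x \<in> S" "z \<in> S" "x \<noteq> z" "1 \<le> l" "l \<le> m" "m < card V"
    and "X \<subseteq> avoiding V S m" "0 \<le> excess V m X"
  shows "excess V l (avoiding V S l) * excess V m X \<le> excess V m (avoiding V S m) * excess V l (lower X l)"
  using assms(7,6)
proof (induction rule: inc_induct)
  case base
  have "X \<subseteq> nsets V m" using assms(9) avoiding_subset by blast
  thus ?case by (simp add: lower_self)
next
  case (step l)
  have X: "X \<subseteq> nsets V m" using assms(9) avoiding_subset by blast
  have "excess V l (avoiding V S l) * excess V (Suc l) (lower X (Suc l))
    \<le> excess V (Suc l) (avoiding V S (Suc l)) * excess V l (lower X l)"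
    using shadow_excess_avoiding[OF assms(1-5) _ _ lower_avoiding[OF assms(9)], of "Suc l"] step assms(8)
      shadow_lower[OF _ X, of l] lower_excess_nsets[OF assms(1) _ _ assms(8) X assms(10), of "Suc l"] by simp
  thus ?case
    using chain_ratio[of "excess V (Suc l) (avoiding V S (Suc l))"] step assms
      excess_avoiding_pos[OF assms(1), of x S z "Suc l"] excess_avoiding_nonneg[OF assms(1), of x S]
    by (auto simp: subset_iff)
qed

text \<open>Some step of the descent from \<open>m\<close> to \<open>card S\<close> is strict. If
  the excess at level \<open>card S + 1\<close> is not maximal, it is the last one, by
  \<open>shadow_excess_strict\<close>. Otherwise the ratio has risen from below one to one before
  that last step.\<close>

lemma lower_excess_strict:
  assumes V: "finite V" "S \<subseteq> V" "2 \<le> card S" and m: "card S < m" "m < card V"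
    and X: "X \<subseteq> avoiding V S m" "0 < excess V m X" "excess V m X < excess V m (avoiding V S m)"
  shows "excess V (card S) (avoiding V S (card S)) * excess V m X
    < excess V m (avoiding V S m) * excess V (card S) (lower X (card S))"
proof -
  define s where "s = card S"
  obtain x z where xz: "x \<in> S" "z \<in> S" "x \<noteq> z"
    using V(3) card_2_iff' obtain_subset_with_card_n[of 2 S] by (metis subsetD)
  define q where "q j = excess V j (avoiding V S j)" for j
  define y where "y j = excess V j (lower X j)" for j
  have Xn: "X \<subseteq> nsets V m" using X(1) avoiding_subset by blast
  have q: "0 < q m" "0 < q (s + 1)" "0 < q s" unfolding q_def using V m xz s_def
    by (auto intro!: excess_avoiding_pos[of _ x _ z])
  have ym: "y m = excess V m X" using lower_self[OF Xn] by (simp add: y_def)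
  have 1: "q (s + 1) * y m \<le> q m * y (s + 1)"
    using lower_excess_avoiding[OF V(1,2) xz, of "s + 1" m X] m X s_def ym by (simp add: q_def y_def)
  have "0 < q (s + 1) * y m" using q X ym by simp
  hence pos: "0 < y (s + 1)" using 1 q by (smt (verit) mult_nonneg_nonpos)
  have le: "y (s + 1) \<le> q (s + 1)" unfolding y_def q_def
    by (rule excess_mono[OF V(1) lower_avoiding[OF X(1)] avoiding_subset])
  have sl: "shadow (lower X (s + 1)) = lower X s" using shadow_lower[OF _ Xn, of s] m s_def by simp
  have 2: "q s * y (s + 1) \<le> q (s + 1) * y s"
    using shadow_excess_avoiding[OF V(1,2) xz _ _ lower_avoiding[OF X(1)], of "s + 1"] pos m s_def sl
    by (simp add: q_def y_def)
  have "q (s + 1) * (q s * y m) < q (s + 1) * (q m * y s)"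
  proof (cases "y (s + 1) = q (s + 1)")
    case True
    have "q (s + 1) * (q s * y m) < q (s + 1) * (q s * q m)" using q X ym q_def by simp
    also have "\<dots> = q m * (q s * y (s + 1))" using True by simp
    also have "\<dots> \<le> q m * (q (s + 1) * y s)" using 2 q by simp
    finally show ?thesis by (simp add: ac_simps)
  next
    case False
    have "card S + 2 \<le> card V" using m by simp
    hence "q s * y (s + 1) < q (s + 1) * y s"
      using shadow_excess_strict[OF V _ lower_avoiding[OF X(1)]] pos le False sl unfolding s_def q_def y_def
      by simp
    hence "q m * (q s * y (s + 1)) < q m * (q (s + 1) * y s)" using q by simp
    moreover have "q s * (q (s + 1) * y m) \<le> q s * (q m * y (s + 1))" using 1 q by simp
    ultimately show ?thesis by (simp add: ac_simps)
  qed
  thus ?thesis using q ym unfolding s_def q_def y_def by simp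
qed

text \<open>The ratio estimate carries a nonpositive excess at level \<open>l\<close> back up to
  level \<open>m - 1\<close>, where \<open>shadow_star\<close> applies.\<close>

lemma lower_star:
  assumes "finite V" "1 \<le> l" "l < m" "m < card V" "X \<subseteq> nsets V m"
    and "excess V m X = 0" "excess V l (lower X l) \<le> 0"
  shows "\<exists>x\<in>V. X = nsets (V - {x}) m"
proof -
  let ?Y = "lower X (m - 1)"
  have l: "l \<le> m - 1" "m - 1 \<le> m" "m - 1 < card V" using assms by auto
  have Y: "?Y \<subseteq> nsets V (m - 1)" by (rule lower_subset[OF assms(5)])
  have sh: "shadow X = ?Y" using shadow_eq_lower[OF assms(5)] assms by simp
  hence y: "0 \<le> excess V (m - 1) ?Y" using shadow_excess_nsets[OF assms(1) _ _ assms(5)] assms by simp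
  have "excess V l (nsets V l) * excess V (m - 1) ?Y \<le> excess V (m - 1) (nsets V (m - 1)) * excess V l (lower X l)"
    using lower_excess_nsets[OF assms(1,2) l(1,3) Y y] lower_lower[OF l(1,2) assms(5)] by simp
  also have "\<dots> \<le> 0" using excess_nsets_nonneg[OF assms(1)] assms(7) by (simp add: mult_nonneg_nonpos)
  finally have "excess V (m - 1) ?Y \<le> 0"
    using excess_nsets_pos[of l V] assms by (simp add: mult_le_0_iff)
  thus ?thesis using shadow_star[OF assms(1) _ assms(4,5,6)] sh assms by simp
qed

section \<open>Cross-intersecting pairs\<close>

text \<open>Together with \<open>meeting\<close> this describes the extremal configuration given by
  \<open>S\<close>: the distinguished family takes the sets meeting \<open>S\<close>, the others the
  sets containing it. For a singleton the two notions coincide.\<close>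

definition supersets :: "'a set \<Rightarrow> 'a set \<Rightarrow> nat \<Rightarrow> 'a set set" where
  "supersets V S m = {A \<in> nsets V m. S \<subseteq> A}"

definition meeting :: "'a set \<Rightarrow> 'a set \<Rightarrow> nat \<Rightarrow> 'a set set" where
  "meeting V S m = {A \<in> nsets V m. S \<inter> A \<noteq> {}}"

lemma card_supersets:
  assumes "finite V" "S \<subseteq> V" "card S \<le> m"
  shows "card (supersets V S m) = card V - card S choose (m - card S)"
proof -
  have fS: "finite S" using assms finite_subset by metis
  have "bij_betw (\<lambda>B. B \<union> S) (nsets (V - S) (m - card S)) (supersets V S m)"
  proof (rule bij_betw_byWitness[where f' = "\<lambda>A. A - S"])
    show "(\<lambda>B. B \<union> S) ` nsets (V - S) (m - card S) \<subseteq> supersets V S m"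
    proof clarify
      fix B assume "B \<in> nsets (V - S) (m - card S)"
      hence B: "B \<subseteq> V - S" "finite B" "card B = m - card S" by (auto simp: nsets_def)
      hence "card (B \<union> S) = m" using fS assms(3) by (subst card_Un_disjoint) auto
      thus "B \<union> S \<in> supersets V S m" using B fS assms(2) by (auto simp: supersets_def nsets_def)
    qed
    show "(\<lambda>A. A - S) ` supersets V S m \<subseteq> nsets (V - S) (m - card S)"
      using fS by (auto simp: supersets_def nsets_def card_Diff_subset)
  qed (auto simp: supersets_def nsets_def)
  hence "card (supersets V S m) = card (nsets (V - S) (m - card S))"
    using bij_betw_same_card by metis
  thus ?thesis using assms fS by (simp add: card_nsets card_Diff_subset)
qed

lemma card_meeting:
  assumes "finite V" "S \<subseteq> V"
  shows "card (meeting V S m) + (card V - card S choose m) = card V choose m"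
proof -
  have fS: "finite S" using assms finite_subset by metis
  have "nsets V m = meeting V S m \<union> nsets (V - S) m" "meeting V S m \<inter> nsets (V - S) m = {}"
    by (auto simp: meeting_def nsets_def)
  moreover have "finite (meeting V S m)" "finite (nsets (V - S) m)"
    using assms finite_imp_finite_nsets[of V m] finite_imp_finite_nsets[of "V - S" m] by (auto simp: meeting_def)
  ultimately have "card (nsets V m) = card (meeting V S m) + card (nsets (V - S) m)"
    by (simp add: card_Un_disjoint)
  thus ?thesis using assms fS by (simp add: card_nsets card_Diff_subset)
qed

lemma card_avoiding:
  assumes "finite V" "S \<subseteq> V" "card S \<le> m"
  shows "card (avoiding V S m) + (card V - card S choose (m - card S)) = card V choose m"
proof -
  have "nsets V m = avoiding V S m \<union> supersets V S m" "avoiding V S m \<inter> supersets V S m = {}"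
    by (auto simp: avoiding_def supersets_def)
  moreover have "finite (avoiding V S m)" "finite (supersets V S m)"
    using finite_imp_finite_nsets[OF assms(1), of m] by (auto simp: avoiding_def supersets_def)
  ultimately have "card (nsets V m) = card (avoiding V S m) + card (supersets V S m)"
    by (simp add: card_Un_disjoint)
  thus ?thesis using assms by (simp add: card_nsets card_supersets)
qed

text \<open>It shows that a \<open>b\<close>-set missing a point \<open>z\<close> of
  \<open>S\<close> cannot cross-intersect all \<open>a\<close>-sets that meet \<open>S\<close>. The
  \<open>a - 1\<close> points besides \<open>z\<close> are available because
  \<open>a + b <= card V\<close>.\<close>

lemma obtain_nset_disjoint:
  assumes "finite V" "B \<in> nsets V b" "z \<in> V" "z \<notin> B" "1 \<le> a" "a + b \<le> card V"
  obtains A where "A \<in> nsets V a" "z \<in> A" "A \<inter> B = {}"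
proof -
  have B: "B \<subseteq> V" "finite B" "card B = b" using assms by (auto simp: nsets_def)
  have "card (V - insert z B) = card V - Suc b"
    using B assms by (subst card_Diff_subset) auto
  hence "a - 1 \<le> card (V - insert z B)" using assms by simp
  then obtain C where C: "C \<subseteq> V - insert z B" "card C = a - 1" "finite C"
    using obtain_subset_with_card_n[of "a - 1" "V - insert z B"] by blast
  have "z \<notin> C" using C by auto
  hence "insert z C \<in> nsets V a" using C assms by (auto simp: nsets_def)
  thus ?thesis using that[of "insert z C"] C assms by auto
qed

section \<open>A cross-intersecting pair and the complements of its first family\<close>

locale cross_pair =
  fixes V :: "'a set" and \<A> \<B> :: "'a set set" and a b :: nat
  assumes finite_V: "finite V"
    and \<A>: "\<A> \<subseteq> nsets V a" and \<B>: "\<B> \<subseteq> nsets V b"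
    and pos: "1 \<le> a" "1 \<le> b"
    and card_V: "a + b \<le> card V"
    and cross: "\<And>A B. A \<in> \<A> \<Longrightarrow> B \<in> \<B> \<Longrightarrow> A \<inter> B \<noteq> {}"
begin

definition X :: "'a set set" where "X = (\<lambda>A. V - A) ` \<A>"

lemma X_subset: "X \<subseteq> nsets V (card V - a)"
proof
  fix B assume "B \<in> X"
  then obtain A where A: "A \<in> \<A>" "B = V - A" by (auto simp: X_def)
  hence "A \<subseteq> V" "finite A" "card A = a" using \<A> by (auto simp: nsets_def)
  thus "B \<in> nsets V (card V - a)" using A finite_V by (simp add: nsets_iff card_Diff_subset)
qed

lemma card_X: "card X = card \<A>"
proof -
  have "inj_on (\<lambda>A. V - A) \<A>"
  proof (rule inj_onI)
    fix A B assume AB: "A \<in> \<A>" "B \<in> \<A>" "V - A = V - B"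
    hence "A \<subseteq> V" "B \<subseteq> V" using \<A> by (auto simp: nsets_def)
    thus "A = B" using AB(3) by (metis double_diff subset_refl)
  qed
  thus ?thesis unfolding X_def by (rule card_image)
qed

lemma level: "b \<le> card V - a" "card V - a < card V"
  using card_V pos by auto

text \<open>Symmetry of binomials turns the number of \<open>(card V - a)\<close>-sets missing a
  point into the number of \<open>a\<close>-sets through it. The lower bound on the distinguished
  family thus says that \<open>X\<close> has nonnegative excess.\<close>

lemma excess_X: "excess V (card V - a) X = int (card \<A>) - int (card V - 1 choose (a - 1))"
proof -
  have "card V - 1 - (card V - a) = a - 1" using card_V pos by simp
  thus ?thesis using binomial_symmetric[of "card V - a" "card V - 1"] card_V pos
    by (simp add: excess_def card_X)
qed

text \<open>A \<open>b\<close>-set inside a complement \<open>V - A\<close> is disjoint from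
  \<open>A\<close>, so \<open>\<B>\<close> shares no set with the iterated shadow of
  \<open>X\<close>. Pascal's rule expresses the room that is left.\<close>

lemma excess_lower: "excess V b (lower X b) \<le> int (card V - 1 choose (b - 1)) - int (card \<B>)"
proof -
  have "\<B> \<inter> lower X b = {}"
  proof (rule ccontr)
    assume "\<B> \<inter> lower X b \<noteq> {}"
    then obtain A B where "B \<in> \<B>" "A \<in> \<A>" "B \<subseteq> V - A" by (auto simp: lower_def X_def)
    thus False using cross[of A B] by auto
  qed
  moreover have "\<B> \<union> lower X b \<subseteq> nsets V b" using \<B> lower_subset[OF X_subset] by simp
  moreover have "finite \<B>" "finite (lower X b)"
    using finite_subfamily[OF finite_V \<B>] finite_subfamily[OF finite_V lower_subset[OF X_subset]] by auto
  ultimately have "card \<B> + card (lower X b) \<le> card V choose b"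
    using card_mono[OF finite_imp_finite_nsets[OF finite_V], of "\<B> \<union> lower X b" b]
    by (simp add: card_Un_disjoint card_nsets)
  moreover have "card V choose b = (card V - 1 choose (b - 1)) + (card V - 1 choose b)"
    using choose_reduce_nat[of "card V" b] card_V pos by simp
  ultimately show ?thesis by (simp add: excess_def)
qed

lemma card_le:
  assumes "card V - 1 choose (a - 1) \<le> card \<A>"
  shows "card \<B> \<le> card V - 1 choose (b - 1)"
proof -
  have "0 \<le> excess V b (lower X b)"
    using lower_excess_nsets[OF finite_V pos(2) level X_subset] assms by (simp add: excess_X)
  thus ?thesis using excess_lower by simp
qed

lemma X_avoiding:
  assumes "S \<subseteq> V" "\<And>A. A \<in> \<A> \<Longrightarrow> S \<inter> A \<noteq> {}"
  shows "X \<subseteq> avoiding V S (card V - a)"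
  using X_subset assms by (auto simp: avoiding_def X_def)

text \<open>Complementation matches the sets of \<open>avoiding\<close> at level
  \<open>card V - a\<close> with the \<open>a\<close>-sets that meet \<open>S\<close>. This
  translates the comparison excesses into the sizes of the two extremal configurations.\<close>

lemma excess_avoiding:
  assumes "S \<subseteq> V" "1 \<le> card S" "card S \<le> b"
  shows "excess V (card V - a) (avoiding V S (card V - a))
      = int (card (meeting V S a)) - int (card V - 1 choose (a - 1))"
    and "excess V b (avoiding V S b)
      = int (card V - 1 choose (b - 1)) - int (card V - card S choose (b - card S))"
proof -
  have 1: "card S \<le> card V - a" using level assms by simp
  have 2: "card V - card S - (card V - a - card S) = a" "card V - 1 - (card V - a) = a - 1"
    using 1 card_V pos by auto
  have s: "card V choose (card V - a) = card V choose a"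
    "card V - card S choose (card V - a - card S) = card V - card S choose a"
    "card V - 1 choose (card V - a) = card V - 1 choose (a - 1)"
    using binomial_symmetric[of a "card V"] binomial_symmetric[of "card V - a - card S" "card V - card S"]
      binomial_symmetric[of "card V - a" "card V - 1"] 1 2 card_V pos by auto
  show "excess V (card V - a) (avoiding V S (card V - a))
      = int (card (meeting V S a)) - int (card V - 1 choose (a - 1))"
    using card_avoiding[OF finite_V assms(1) 1] card_meeting[OF finite_V assms(1), of a] s
    by (simp add: excess_def)
  have "card V choose b = (card V - 1 choose (b - 1)) + (card V - 1 choose b)"
    using choose_reduce_nat[of "card V" b] card_V pos by simp
  thus "excess V b (avoiding V S b)
      = int (card V - 1 choose (b - 1)) - int (card V - card S choose (b - card S))"
    using card_avoiding[OF finite_V assms(1,3)] by (simp add: excess_def)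
qed

lemma weighted:
  assumes "card V - 1 choose (a - 1) \<le> card \<A>"
    and S: "S \<subseteq> V" "1 \<le> card S" "card S \<le> b" "\<And>A. A \<in> \<A> \<Longrightarrow> S \<inter> A \<noteq> {}"
  shows "(int (card \<A>) - int (card V - 1 choose (a - 1))) *
        (int (card V - 1 choose (b - 1)) - int (card V - card S choose (b - card S)))
    \<le> (int (card (meeting V S a)) - int (card V - 1 choose (a - 1))) *
        (int (card V - 1 choose (b - 1)) - int (card \<B>))"
proof -
  have av: "X \<subseteq> avoiding V S (card V - a)" using X_avoiding S by blast
  have nn: "0 \<le> excess V (card V - a) (avoiding V S (card V - a))"
  proof -
    obtain x where "x \<in> S" using S(2) by fastforce
    thus ?thesis using excess_avoiding_nonneg[OF finite_V] S(1) by auto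
  qed
  have "excess V b (avoiding V S b) * excess V (card V - a) X
    \<le> excess V (card V - a) (avoiding V S (card V - a)) * excess V b (lower X b)"
  proof (cases "card S = 1")
    case True
    \<comment> \<open>A singleton does not have the two points that the ratio estimate asks for, but
      its comparison excess is zero.\<close>
    hence "excess V b (avoiding V S b) = 0" using excess_avoiding(2)[OF S(1-3)] by simp
    moreover have "0 \<le> excess V b (lower X b)"
      using lower_excess_nsets[OF finite_V pos(2) level X_subset] assms by (simp add: excess_X)
    ultimately show ?thesis using nn by simp
  next
    case False
    hence "2 \<le> card S" using S(2) by simp
    then obtain x z where xz: "x \<in> S" "z \<in> S" "x \<noteq> z"
      using card_2_iff' obtain_subset_with_card_n[of 2 S] by (metis subsetD)
    show ?thesis
      using lower_excess_avoiding[OF finite_V S(1) xz pos(2) level av] assms(1) by (simp add: excess_X)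
  qed
  also have "\<dots> \<le> excess V (card V - a) (avoiding V S (card V - a)) *
      (int (card V - 1 choose (b - 1)) - int (card \<B>))"
    using excess_lower nn by (rule mult_left_mono)
  finally show ?thesis by (simp add: excess_avoiding[OF S(1-3)] excess_X mult.commute)
qed

text \<open>By \<open>a + b < card V\<close> the level of \<open>X\<close> lies strictly above
  \<open>card S\<close>, so the descent has a step in which strictness arises.\<close>

lemma weighted_strict:
  assumes S: "S \<subseteq> V" "2 \<le> card S" "b = card S" "\<And>A. A \<in> \<A> \<Longrightarrow> S \<inter> A \<noteq> {}"
    and "a + b < card V"
    and "card V - 1 choose (a - 1) < card \<A>" "card \<A> < card (meeting V S a)"
  shows "(int (card \<A>) - int (card V - 1 choose (a - 1))) *
        (int (card V - 1 choose (b - 1)) - int (card V - card S choose (b - card S)))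
    < (int (card (meeting V S a)) - int (card V - 1 choose (a - 1))) *
        (int (card V - 1 choose (b - 1)) - int (card \<B>))"
proof -
  have av: "X \<subseteq> avoiding V S (card V - a)" using X_avoiding S by blast
  have s: "1 \<le> card S" "card S \<le> b" "card S < card V - a" using S assms(5) by auto
  note ea = excess_avoiding[OF S(1) s(1,2)]
  have "excess V b (avoiding V S b) * excess V (card V - a) X
    < excess V (card V - a) (avoiding V S (card V - a)) * excess V b (lower X b)"
    using lower_excess_strict[OF finite_V S(1,2) s(3) level(2) av] assms(6,7)
    unfolding S(3)[symmetric] by (simp add: excess_X ea)
  also have "\<dots> \<le> excess V (card V - a) (avoiding V S (card V - a)) *
      (int (card V - 1 choose (b - 1)) - int (card \<B>))"
    using excess_lower assms(6,7) by (intro mult_left_mono) (auto simp: ea)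
  finally show ?thesis by (simp add: ea excess_X mult.commute)
qed

text \<open>The sizes give \<open>X\<close> excess zero and its iterated shadow excess at most zero.
  So \<open>X\<close> consists of all sets missing some point, and that point lies in every member
  of \<open>\<A>\<close>.\<close>

lemma star:
  assumes "a + b < card V" "card \<A> = card V - 1 choose (a - 1)" "card \<B> = card V - 1 choose (b - 1)"
  shows "\<exists>x\<in>V. \<A> = {A \<in> nsets V a. x \<in> A}"
proof -
  have "b < card V - a" using assms(1) by simp
  then obtain x where x: "x \<in> V" "X = nsets (V - {x}) (card V - a)"
    using lower_star[OF finite_V pos(2) _ level(2) X_subset] excess_X excess_lower assms by auto
  have "\<A> \<subseteq> {A \<in> nsets V a. x \<in> A}"
  proof
    fix A assume A: "A \<in> \<A>"
    hence "V - A \<in> nsets (V - {x}) (card V - a)" using x by (auto simp: X_def)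
    thus "A \<in> {A \<in> nsets V a. x \<in> A}" using A \<A> x(1) by (auto simp: nsets_def)
  qed
  moreover have "{A \<in> nsets V a. x \<in> A} = supersets V {x} a" by (auto simp: supersets_def)
  hence "card {A \<in> nsets V a. x \<in> A} = card \<A>"
    using card_supersets[OF finite_V, of "{x}" a] x pos assms by simp
  moreover have "finite {A \<in> nsets V a. x \<in> A}" using finite_imp_finite_nsets[OF finite_V] by simp
  ultimately have "\<A> = {A \<in> nsets V a. x \<in> A}" by (intro card_subset_eq) auto
  thus ?thesis using x(1) by blast
qed

lemma subset_supersets:
  assumes "meeting V S a \<subseteq> \<A>" "S \<subseteq> V"
  shows "\<B> \<subseteq> supersets V S b"
proof
  fix B assume B: "B \<in> \<B>"
  have "z \<in> B" if z: "z \<in> S" for z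
  proof (rule ccontr)
    assume "z \<notin> B"
    moreover have "B \<in> nsets V b" "z \<in> V" using B \<B> z assms(2) by auto
    ultimately obtain A where "A \<in> nsets V a" "z \<in> A" "A \<inter> B = {}"
      using obtain_nset_disjoint[OF finite_V _ _ _ pos(1) card_V] by metis
    thus False using cross[of A B] B assms z by (auto simp: meeting_def)
  qed
  thus "B \<in> supersets V S b" using B \<B> by (auto simp: supersets_def)
qed

end

section \<open>Adding up the estimates for all families\<close>

text \<open>Here \<open>y\<close> stands for the excess of the distinguished family,
  \<open>w\<close> for its largest value, \<open>g i\<close> for the deficit of another family below
  a star, and \<open>d i\<close> for that deficit in the configuration with \<open>y = w\<close>.
  The summed estimates put \<open>y - sum g I\<close> below the line from \<open>0\<close> at
  \<open>y = 0\<close> to \<open>w - sum d I\<close> at \<open>y = w\<close>, and a line is bounded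
  by its larger end. Equality in the interior makes the line constant and every single estimate an
  equality.\<close>

lemma interpolation:
  fixes y w :: int and g d :: "'i \<Rightarrow> int"
  assumes "finite I" "0 \<le> y" "y \<le> w" "\<And>i. i \<in> I \<Longrightarrow> 0 \<le> g i" "\<And>i. i \<in> I \<Longrightarrow> y * d i \<le> w * g i"
  shows "y - sum g I \<le> max 0 (w - sum d I)"
    and "y - sum g I = max 0 (w - sum d I) \<Longrightarrow>
      (y = 0 \<and> (\<forall>i\<in>I. g i = 0) \<and> w - sum d I \<le> 0) \<or> (y = w \<and> 0 \<le> w - sum d I) \<or>
      (0 < y \<and> y < w \<and> (\<forall>i\<in>I. y * d i = w * g i))"
proof -
  have "sum (\<lambda>i. y * d i) I \<le> sum (\<lambda>i. w * g i) I" by (intro sum_mono assms(5))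
  hence *: "y * sum d I \<le> w * sum g I" by (simp add: sum_distrib_left)
  hence wt: "w * (y - sum g I) \<le> y * (w - sum d I)" by (simp add: algebra_simps)
  have g: "0 \<le> sum g I" by (intro sum_nonneg assms(4))
  show "y - sum g I \<le> max 0 (w - sum d I)"
  proof (cases "w - sum d I \<le> 0 \<or> w = 0")
    case True
    thus ?thesis
    proof
      assume "w - sum d I \<le> 0"
      hence "y * (w - sum d I) \<le> 0" using assms(2) by (simp add: mult_nonneg_nonpos)
      hence "w * (y - sum g I) \<le> 0" using wt by linarith
      hence "w = 0 \<or> y - sum g I \<le> 0" using assms(2,3) by (auto simp: mult_le_0_iff)
      thus ?thesis using g assms(2,3) by auto
    qed (use g assms(2,3) in auto)
  next
    case False
    hence "y * (w - sum d I) \<le> w * (w - sum d I)" using assms(3) by (intro mult_right_mono) auto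
    hence "w * (y - sum g I) \<le> w * (w - sum d I)" using wt by linarith
    thus ?thesis using False assms(2,3) by auto
  qed
  assume eq: "y - sum g I = max 0 (w - sum d I)"
  consider "y = 0" | "y = w" "0 < w" | "0 < y" "y < w" using assms(2,3) by linarith
  thus "(y = 0 \<and> (\<forall>i\<in>I. g i = 0) \<and> w - sum d I \<le> 0) \<or> (y = w \<and> 0 \<le> w - sum d I) \<or>
      (0 < y \<and> y < w \<and> (\<forall>i\<in>I. y * d i = w * g i))"
  proof cases
    case 1
    hence "sum g I = 0" "w - sum d I \<le> 0" using eq g by auto
    thus ?thesis using 1 assms(1,4) sum_nonneg_eq_0_iff[of I g] by auto
  next
    case 2
    hence "y - sum g I \<le> w - sum d I" using wt by simp
    thus ?thesis using 2 eq by simp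
  next
    case 3
    \<comment> \<open>At an interior point a nonconstant line lies strictly below its larger
      end.\<close>
    have "w - sum d I = 0"
    proof (rule ccontr)
      assume ne: "w - sum d I \<noteq> 0"
      show False
      proof (cases "w - sum d I > 0")
        case True
        hence "w * (w - sum d I) \<le> y * (w - sum d I)" using wt eq by simp
        thus False using True 3 by simp
      next
        case False
        hence "y * (w - sum d I) < 0" using ne 3 by (simp add: mult_pos_neg)
        moreover have "y - sum g I = 0" using eq False by simp
        ultimately show False using wt by simp
      qed
    qed
    hence "sum g I = y" "sum d I = w" using eq by auto
    hence "sum (\<lambda>i. w * g i - y * d i) I = 0" by (simp add: sum_subtractf flip: sum_distrib_left)
    hence "\<forall>i\<in>I. w * g i - y * d i = 0"
      using assms(1,5) by (subst (asm) sum_nonneg_eq_0_iff) auto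
    thus ?thesis using 3 by auto
  qed
qed

section \<open>The bound for \<open>r\<close> families and its equality cases\<close>

theorem theorem1p6:
  fixes r n istar kbar :: nat
    and k :: "nat \<Rightarrow> nat"
    and F :: "nat \<Rightarrow> nat set set"
  assumes "r \<ge> 2"
    and "n \<ge> 1"
    and "\<forall>i\<in>{1..r}. k i \<ge> 1"
    and "\<forall>i\<in>{1..r}. F i \<subseteq> nsets {1..n} (k i)"
    and "\<forall>i\<in>{1..r}. F i \<noteq> {}"
    and "cross_intersecting r F"
    and "istar \<in> {1..r}"
    and "card (F istar) \<ge> (n - 1) choose (k istar - 1)"
    and "kbar = Min (k ` ({1..r} - {istar}))"
    and "\<forall>i\<in>{1..r} - {istar}. n \<ge> k i + k istar"
  shows
    "let M1 = (n choose k istar) - ((n - kbar) choose k istar)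
                + (\<Sum>i\<in>{1..r} - {istar}. (n - kbar) choose (k i - kbar));
         M2 = (\<Sum>i=1..r. (n - 1) choose (k i - 1))
     in (\<Sum>i=1..r. card (F i)) \<le> max M1 M2 \<and>
        ((\<Sum>i=1..r. card (F i)) = max M1 M2 \<longleftrightarrow>
          ((\<forall>i\<in>{1..r} - {istar}. k i = kbar) \<and> n = kbar + k istar \<longrightarrow>
             (r = 2 \<longrightarrow>
                F istar = nsets {1..n} (k istar) - complements n (F (3 - istar)) \<and>
                1 \<le> card (F (3 - istar)) \<and>
                card (F (3 - istar)) \<le> (n - 1) choose (kbar - 1)) \<and>
             (r > 2 \<and> n > 2 * kbar \<longrightarrow>
                (\<exists>x\<in>{1..n}.
                   F istar = {A \<in> nsets {1..n} (k istar). x \<in> A} \<and>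
                   (\<forall>i\<in>{1..r} - {istar}. F i = {A \<in> nsets {1..n} kbar. x \<in> A}))) \<and>
             (r > 2 \<and> n \<le> 2 * kbar \<longrightarrow>
                (\<exists>\<F>. \<F> \<subseteq> nsets {1..n} kbar \<and> intersecting \<F> \<and>
                   card \<F> = (n - 1) choose (kbar - 1) \<and>
                   (\<forall>i\<in>{1..r} - {istar}. F i = \<F>) \<and>
                   F istar = nsets {1..n} (k istar) - complements n \<F>))) \<and>
          (n > kbar + k istar \<longrightarrow>
             (\<exists>s. (s = 1 \<and> M2 = max M1 M2 \<or> s = kbar \<and> M1 = max M1 M2) \<and>
                (\<exists>S\<in>nsets {1..n} s.
                   F istar = {A \<in> nsets {1..n} (k istar). S \<inter> A \<noteq> {}} \<and>
                   (\<forall>i\<in>{1..r} - {istar}. F i = {A \<in> nsets {1..n} (k i). S \<subseteq> A})))))"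
proof -
  define a I V where "a = k istar" and "I = {1..r} - {istar}" and "V = {1..n}"
  define \<alpha> where "\<alpha> = n - 1 choose (a - 1)"
  define \<beta> where "\<beta> i = n - 1 choose (k i - 1)" for i
  define c where "c i = n - kbar choose (k i - kbar)" for i
  define M1 where "M1 = (n choose k istar) - ((n - kbar) choose k istar)
                + (\<Sum>i\<in>{1..r} - {istar}. (n - kbar) choose (k i - kbar))"
  define M2 where "M2 = (\<Sum>i=1..r. (n - 1) choose (k i - 1))"
  define T where "T = (\<Sum>i=1..r. card (F i))"
  have V: "finite V" "card V = n" by (auto simp: V_def)
  have I: "finite I" "istar \<notin> I" "{1..r} = insert istar I" using assms(7) by (auto simp: I_def)
  have cI: "card I = r - 1" using assms(7) by (simp add: I_def)
  hence neI: "I \<noteq> {}" using assms(1) by auto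
  have kbar: "kbar = Min (k ` I)" using assms(9) by (simp add: I_def)
  have kle: "kbar \<le> k i" if "i \<in> I" for i using that I(1) by (simp add: kbar)
  \<comment> \<open>An index attaining the minimum provides one reference set \<open>S\<close> for
    all pairs: every member of \<open>F istar\<close> meets it, and its size \<open>kbar\<close> is
    at most every \<open>k i\<close>.\<close>
  obtain b where b: "b \<in> I" "k b = kbar"
    using Min_in[of "k ` I"] I(1) neI by (metis finite_imageI image_iff image_is_empty kbar)
  have k1: "1 \<le> k i" "F i \<subseteq> nsets V (k i)" "F i \<noteq> {}" if "i \<in> {1..r}" for i
    using that assms(3,4,5) by (auto simp: V_def)
  have kI: "a + k i \<le> n" if "i \<in> I" for i
    using that bspec[OF assms(10), of i] by (simp add: I_def a_def add.commute)
  have Ir: "i \<in> {1..r}" "i \<noteq> istar" if "i \<in> I" for i using that by (auto simp: I_def)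
  note kI1 = k1[OF Ir(1)]
  have pair_cross: "A \<inter> B \<noteq> {}" if "i \<in> {1..r}" "j \<in> {1..r}" "i \<noteq> j" "A \<in> F i" "B \<in> F j" for i j A B
  proof -
    have "1 \<le> card (A \<inter> B) \<or> 1 \<le> card (B \<inter> A)"
      using that assms(6) unfolding cross_intersecting_def by (cases i j rule: linorder_cases) auto
    thus ?thesis by (auto simp: Int_commute)
  qed
  have pair: "cross_pair V (F istar) (F i) a (k i)" if i: "i \<in> I" for i
  proof
    show "F i \<subseteq> nsets V (k i)" "1 \<le> k i" using kI1[OF i] by auto
    show "A \<inter> B \<noteq> {}" if "A \<in> F istar" "B \<in> F i" for A B
      using pair_cross[OF assms(7) Ir(1)[OF i] Ir(2)[OF i, symmetric]] that by blast
  qed (use k1[OF assms(7)] kI[OF i] V in \<open>auto simp: a_def\<close>)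
  have Fa: "\<alpha> \<le> card (F istar)" "F istar \<subseteq> nsets V a"
    using assms(8) k1[OF assms(7)] by (auto simp: \<alpha>_def a_def)
  obtain S where S: "S \<in> F b" using kI1(3)[OF b(1)] by blast
  have S': "S \<subseteq> V" "card S = kbar" using S kI1(2)[OF b(1)] b(2) by (auto simp: nsets_def)
  have kb1: "1 \<le> kbar" "a + kbar \<le> n" "1 \<le> a" using b(2) kI1(1)[OF b(1)] k1(1)[OF assms(7)] kI[OF b(1)] by (auto simp: a_def)
  have mS: "S \<inter> A \<noteq> {}" if "A \<in> F istar" for A
    using pair_cross[OF assms(7) Ir(1)[OF b(1)] Ir(2)[OF b(1), symmetric] that S] by auto
  define w where "w = card (meeting V S a)"
  have w_eq: "w = (n choose a) - (n - kbar choose a)"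
    using card_meeting[OF V(1) S'(1), of a] S'(2) V by (simp add: w_def)
  have Fm: "F istar \<subseteq> meeting V S a" using Fa(2) mS by (auto simp: meeting_def)
  have fm: "finite (meeting V S a)" using finite_imp_finite_nsets[OF V(1)] by (simp add: meeting_def)
  have Faw: "card (F istar) \<le> w" unfolding w_def by (rule card_mono[OF fm Fm])
  have M1: "M1 = w + sum c I" by (simp add: M1_def w_eq c_def I_def a_def)
  have M2: "M2 = \<alpha> + sum \<beta> I"
    unfolding M2_def I(3) using I(1,2) by (simp add: \<alpha>_def \<beta>_def a_def)
  have T: "T = card (F istar) + (\<Sum>i\<in>I. card (F i))"
    unfolding T_def I(3) using I(1,2) by simp
  \<comment> \<open>Sizes are measured from the configuration of stars, whose total is
    \<open>M2\<close>; the opposite end, with \<open>F istar\<close> equal to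
    \<open>meeting V S a\<close>, has total \<open>M1\<close>.\<close>
  define y where "y = int (card (F istar)) - int \<alpha>"
  define g where "g i = int (\<beta> i) - int (card (F i))" for i
  define d where "d i = int (\<beta> i) - int (c i)" for i
  have y: "0 \<le> y" "y \<le> int w - int \<alpha>" using Fa Faw by (auto simp: y_def)
  have g: "0 \<le> g i" if "i \<in> I" for i
    using cross_pair.card_le[OF pair[OF that]] Fa(1) V by (simp add: g_def \<alpha>_def \<beta>_def)
  have yd: "y * d i \<le> (int w - int \<alpha>) * g i" if "i \<in> I" for i
    using cross_pair.weighted[OF pair[OF that] _ S'(1) _ _ mS] Fa(1) V S' kb1 kle[OF that]
    by (simp add: y_def d_def g_def w_def \<alpha>_def \<beta>_def c_def)
  have T_int: "int T - int M2 = y - sum g I"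
    by (simp add: T M2 y_def g_def sum_subtractf)
  have M_int: "int M1 - int M2 = int w - int \<alpha> - sum d I"
    by (simp add: M1 M2 d_def sum_subtractf)
  have "y - sum g I \<le> max 0 (int w - int \<alpha> - sum d I)"
    by (rule interpolation(1)[OF I(1) y]) (use g yd in auto)
  hence bound: "T \<le> max M1 M2" using T_int M_int by (auto simp: max_def split: if_splits)
  have card_star: "card {A \<in> nsets V m. x \<in> A} = n - 1 choose (m - 1)" if "x \<in> V" "1 \<le> m" for x m
    using card_supersets[OF V(1), of "{x}" m] that V by (simp add: supersets_def)

  \<comment> \<open>The equality clause of \<open>interpolation\<close> leaves stars, the
    configuration given by \<open>S\<close>, or an interior point; the last is excluded by
    strictness at index \<open>b\<close>.\<close>
  have eq_big: "T = max M1 M2 \<longleftrightarrow>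
      (\<exists>s. (s = 1 \<and> M2 = max M1 M2 \<or> s = kbar \<and> M1 = max M1 M2) \<and>
         (\<exists>S\<in>nsets V s. F istar = {A \<in> nsets V (k istar). S \<inter> A \<noteq> {}} \<and>
            (\<forall>i\<in>I. F i = {A \<in> nsets V (k i). S \<subseteq> A})))" (is "_ \<longleftrightarrow> ?R")
    if big: "kbar + a < n"
  proof
    assume "T = max M1 M2"
    hence "y - sum g I = max 0 (int w - int \<alpha> - sum d I)"
      using T_int M_int by (auto simp: max_def split: if_splits)
    hence "y = 0 \<and> (\<forall>i\<in>I. g i = 0) \<and> int w - int \<alpha> - sum d I \<le> 0 \<or>
      y = int w - int \<alpha> \<and> 0 \<le> int w - int \<alpha> - sum d I \<or>
      0 < y \<and> y < int w - int \<alpha> \<and> (\<forall>i\<in>I. y * d i = (int w - int \<alpha>) * g i)"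
      by (intro interpolation(2)[OF I(1) y]) (use g yd in auto)
    then consider "y = 0" "\<forall>i\<in>I. g i = 0" "int w - int \<alpha> - sum d I \<le> 0"
      | "y = int w - int \<alpha>" "0 \<le> int w - int \<alpha> - sum d I"
      | "0 < y" "y < int w - int \<alpha>" "\<forall>i\<in>I. y * d i = (int w - int \<alpha>) * g i" by blast
    thus ?R
    proof cases
      case 1
      have ca: "card (F istar) = \<alpha>" and cF: "card (F i) = \<beta> i" if "i \<in> I" for i
        using 1 that by (auto simp: y_def g_def)
      have M: "M2 = max M1 M2" using 1 M_int by simp
      \<comment> \<open>Other indices may satisfy \<open>a + k i = n\<close>, so the centre
        \<open>x\<close> is taken from the pair with \<open>b\<close>, which has the strict gap
        required by \<open>star\<close>. Cross-intersection then traps every \<open>F i\<close> in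
        the star at \<open>x\<close>.\<close>
      obtain x where x: "x \<in> V" "F istar = {A \<in> nsets V a. x \<in> A}"
        using cross_pair.star[OF pair[OF b(1)]] ca[OF b(1)] cF[OF b(1)] big b V
        by (auto simp: \<alpha>_def \<beta>_def)
      have "F i = {A \<in> nsets V (k i). x \<in> A}" if i: "i \<in> I" for i
      proof (rule card_subset_eq)
        have "meeting V {x} a \<subseteq> F istar" using x by (auto simp: meeting_def)
        hence "F i \<subseteq> supersets V {x} (k i)"
          using cross_pair.subset_supersets[OF pair[OF i]] x by simp
        thus "F i \<subseteq> {A \<in> nsets V (k i). x \<in> A}" by (simp add: supersets_def)
        show "card (F i) = card {A \<in> nsets V (k i). x \<in> A}"
          using cF[OF i] card_star[OF x(1), of "k i"] kI1(1)[OF i] by (simp add: \<beta>_def)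
      qed (use finite_imp_finite_nsets[OF V(1)] in simp)
      hence F: "F istar = {A \<in> nsets V (k istar). {x} \<inter> A \<noteq> {}}"
        "\<forall>i\<in>I. F i = {A \<in> nsets V (k i). {x} \<subseteq> A}"
        using x by (auto simp: a_def)
      show ?thesis
      proof (intro exI[of _ 1] conjI bexI[of _ "{x}"])
        show "1 = (1::nat) \<and> M2 = max M1 M2 \<or> 1 = kbar \<and> M1 = max M1 M2" using M by blast
        show "{x} \<in> nsets V 1" using x by (auto simp: nsets_def)
      qed (rule F)+
    next
      case 2
      hence "card (F istar) = w" by (simp add: y_def)
      hence Fw: "F istar = meeting V S a" using card_subset_eq[OF fm Fm] by (simp add: w_def)
      have M: "M1 = max M1 M2" using 2 M_int by simp
      have sub: "F i \<subseteq> supersets V S (k i)" if i: "i \<in> I" for i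
        using cross_pair.subset_supersets[OF pair[OF i]] Fw S'(1) by simp
      have cs: "card (supersets V S (k i)) = c i" if i: "i \<in> I" for i
        using card_supersets[OF V(1) S'(1)] kle[OF i] S' V by (simp add: c_def)
      have fs: "finite (supersets V S m)" for m using finite_imp_finite_nsets[OF V(1)] by (simp add: supersets_def)
      have le: "card (F i) \<le> c i" if i: "i \<in> I" for i
        using card_mono[OF fs sub[OF i]] cs[OF i] by simp
      have "(\<Sum>i\<in>I. card (F i)) = sum c I"
        using T M1 M \<open>T = max M1 M2\<close> \<open>card (F istar) = w\<close> by simp
      hence "card (F i) = c i" if "i \<in> I" for i
        using sum_mono_inv[of "\<lambda>i. card (F i)" I c i] le that I(1) by blast
      hence "F i = supersets V S (k i)" if "i \<in> I" for i
        using card_subset_eq[OF fs sub] cs that by simp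
      hence F: "F istar = {A \<in> nsets V (k istar). S \<inter> A \<noteq> {}}"
        "\<forall>i\<in>I. F i = {A \<in> nsets V (k i). S \<subseteq> A}"
        using Fw by (auto simp: supersets_def meeting_def a_def)
      show ?thesis
      proof (intro exI[of _ kbar] conjI bexI[of _ S])
        show "kbar = 1 \<and> M2 = max M1 M2 \<or> kbar = kbar \<and> M1 = max M1 M2" using M by blast
        show "S \<in> nsets V kbar" using S' V(1) by (simp add: nsets_iff)
      qed (rule F)+
    next
      case 3
      show ?thesis
      proof (cases "kbar = 1")
        case True
        \<comment> \<open>For \<open>kbar = 1\<close> the admissible range of \<open>y\<close> is a
          single point and has no interior.\<close>
        hence "w = \<alpha>" using w_eq kb1 choose_reduce_nat[of n a] by (simp add: \<alpha>_def)
        thus ?thesis using 3 by simp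
      next
        case False
        have "y * d b < (int w - int \<alpha>) * g b"
          using cross_pair.weighted_strict[OF pair[OF b(1)] S'(1) _ _ mS] 3(1,2) False kb1 b S' V big
          by (simp add: y_def d_def g_def w_def \<alpha>_def \<beta>_def c_def)
        thus ?thesis using 3 b by simp
      qed
    qed
  next
    assume ?R
    then obtain s S0 where s: "s = 1 \<and> M2 = max M1 M2 \<or> s = kbar \<and> M1 = max M1 M2"
      and S0: "S0 \<in> nsets V s" and FS: "F istar = meeting V S0 a" "\<forall>i\<in>I. F i = supersets V S0 (k i)"
      by (auto simp: supersets_def meeting_def a_def)
    have S0': "S0 \<subseteq> V" "card S0 = s" using S0 by (auto simp: nsets_def)
    have sk: "s \<le> k i" if "i \<in> I" for i using s kle[OF that] kb1 by auto
    have "(\<Sum>i\<in>I. card (F i)) = (\<Sum>i\<in>I. n - s choose (k i - s))"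
      using FS(2) card_supersets[OF V(1) S0'(1)] S0'(2) sk V by (intro sum.cong) auto
    moreover have "card (F istar) = (n choose a) - (n - s choose a)"
      using card_meeting[OF V(1) S0'(1), of a] FS(1) S0'(2) V by simp
    ultimately have Ts: "T = ((n choose a) - (n - s choose a)) + (\<Sum>i\<in>I. n - s choose (k i - s))"
      using T by simp
    from s show "T = max M1 M2"
    proof
      assume 1: "s = 1 \<and> M2 = max M1 M2"
      have "(n choose a) - (n - 1 choose a) = \<alpha>"
        using kb1 choose_reduce_nat[of n a] by (simp add: \<alpha>_def)
      thus ?thesis using 1 Ts M2 by (simp add: \<beta>_def)
    next
      assume "s = kbar \<and> M1 = max M1 M2"
      thus ?thesis using Ts M1 w_eq by (simp add: c_def)
    qed
  qed

  \<comment> \<open>With \<open>n = kbar + a\<close>, two sets of sizes \<open>a\<close> and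
    \<open>kbar\<close> are disjoint only if they are complements, so cross-intersection with
    \<open>F istar\<close> merely forbids complements.\<close>
  have eq_small: "T = max M1 M2 \<longleftrightarrow>
      (r = 2 \<longrightarrow>
         F istar = nsets V (k istar) - complements n (F (3 - istar)) \<and>
         1 \<le> card (F (3 - istar)) \<and> card (F (3 - istar)) \<le> (n - 1) choose (kbar - 1)) \<and>
      (r > 2 \<and> n > 2 * kbar \<longrightarrow>
         (\<exists>x\<in>V. F istar = {A \<in> nsets V (k istar). x \<in> A} \<and>
            (\<forall>i\<in>I. F i = {A \<in> nsets V kbar. x \<in> A}))) \<and>
      (r > 2 \<and> n \<le> 2 * kbar \<longrightarrow>
         (\<exists>\<F>. \<F> \<subseteq> nsets V kbar \<and> intersecting \<F> \<and> card \<F> = (n - 1) choose (kbar - 1) \<and>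
            (\<forall>i\<in>I. F i = \<F>) \<and> F istar = nsets V (k istar) - complements n \<F>))" (is "_ \<longleftrightarrow> ?R")
    if small: "n = kbar + a" and all: "\<forall>i\<in>I. k i = kbar"
  proof -
    define \<beta>0 where "\<beta>0 = n - 1 choose (kbar - 1)"
    have \<beta>: "\<beta> i = \<beta>0" if "i \<in> I" for i using all that by (simp add: \<beta>_def \<beta>0_def)
    have "n - 1 - (a - 1) = kbar" using small kb1 by simp
    hence "\<alpha> = n - 1 choose kbar"
      using binomial_symmetric[of "a - 1" "n - 1"] small kb1 by (simp add: \<alpha>_def)
    moreover have "n choose a = n choose kbar" using binomial_symmetric[of a n] small by simp
    ultimately have \<alpha>\<beta>: "n choose a = \<alpha> + \<beta>0"
      using choose_reduce_nat[of n kbar] small kb1 by (simp add: \<beta>0_def)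
    have \<beta>1: "1 \<le> \<beta>0" using small kb1 by (simp add: \<beta>0_def Suc_le_eq)
    have M2': "M2 = \<alpha> + (r - 1) * \<beta>0" using M2 \<beta> cI by simp
    have M1': "M1 = (n choose a) - 1 + (r - 1)"
    proof -
      have "n - kbar = a" using small by simp
      moreover have "sum c I = (\<Sum>i\<in>I. 1)" using all by (intro sum.cong) (auto simp: c_def)
      ultimately show ?thesis using M1 w_eq cI by simp
    qed
    \<comment> \<open>The difference \<open>M2 - M1\<close> is
      \<open>(r - 2) * (\<beta>0 - 1)\<close>, which is nonnegative.\<close>
    have max: "max M1 M2 = M2"
    proof -
      have r: "r - 1 = Suc (r - 2)" using assms(1) by simp
      have "(r - 2) * 1 \<le> (r - 2) * \<beta>0" using \<beta>1 by (rule mult_le_mono2)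
      thus ?thesis unfolding M1' M2' \<alpha>\<beta> r using \<beta>1 by simp
    qed
    have compl_inj: "card (complements n \<F>) = card \<F>" if "\<F> \<subseteq> nsets V m" for \<F> m
    proof -
      have "complements n \<F> = (\<lambda>A. V - A) ` \<F>" by (auto simp: complements_def V_def)
      moreover have "inj_on (\<lambda>A. V - A) \<F>"
      proof (rule inj_onI)
        fix A B assume AB: "A \<in> \<F>" "B \<in> \<F>" "V - A = V - B"
        hence "A \<subseteq> V" "B \<subseteq> V" using that by (auto simp: nsets_def)
        thus "A = B" using AB(3) by (metis double_diff subset_refl)
      qed
      ultimately show ?thesis by (simp add: card_image)
    qed
    have compl_sub: "complements n \<F> \<subseteq> nsets V a" if "\<F> \<subseteq> nsets V kbar" for \<F>
    proof
      fix B assume "B \<in> complements n \<F>"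
      then obtain A where A: "A \<in> \<F>" "B = V - A" by (auto simp: complements_def V_def)
      hence "A \<subseteq> V" "finite A" "card A = kbar" using that by (auto simp: nsets_def)
      thus "B \<in> nsets V a" using A V small by (simp add: nsets_iff card_Diff_subset)
    qed
    have card_minus: "card (nsets V a - complements n \<F>) = (n choose a) - card \<F>"
      if "\<F> \<subseteq> nsets V kbar" for \<F>
      using card_Diff_subset[OF _ compl_sub[OF that]] compl_inj[OF that] finite_subfamily[OF V(1) compl_sub[OF that]] V
      by (simp add: card_nsets)
    \<comment> \<open>The size of this union bounds every \<open>F i\<close> and also limits
      \<open>F istar\<close>, which contains no complement of a member of \<open>U\<close>.\<close>
    define U where "U = (\<Union>i\<in>I. F i)"
    have FI: "F i \<subseteq> nsets V kbar" if "i \<in> I" for i using kI1(2)[OF that] all that by auto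
    hence U: "U \<subseteq> nsets V kbar" by (auto simp: U_def)
    have fU: "finite U" by (rule finite_subfamily[OF V(1) U])
    have FU: "F i \<subseteq> U" "card (F i) \<le> card U" if "i \<in> I" for i
      using that card_mono[OF fU, of "F i"] by (auto simp: U_def)
    have fminus: "finite (nsets V a - complements n U)" using finite_imp_finite_nsets[OF V(1)] by simp
    have aU: "F istar \<subseteq> nsets V a - complements n U"
    proof
      fix A assume A: "A \<in> F istar"
      have "A \<notin> complements n U"
      proof
        assume "A \<in> complements n U"
        then obtain i B where "i \<in> I" "B \<in> F i" "A = V - B" by (auto simp: complements_def U_def V_def)
        thus False using pair_cross[OF assms(7) Ir(1) Ir(2)[symmetric] A, of i B] by auto
      qed
      thus "A \<in> nsets V a - complements n U" using A Fa by auto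
    qed
    have cU: "card (F istar) \<le> (n choose a) - card U"
      using card_mono[OF fminus aU] card_minus[OF U] by simp
    have "card U \<le> n choose kbar"
      using card_mono[OF finite_imp_finite_nsets[OF V(1)] U] V by (simp add: card_nsets)
    hence Ule: "card U \<le> n choose a" using binomial_symmetric[of a n] small by simp
    have U\<beta>: "card U \<le> \<beta>0" using cU Ule Fa(1) \<alpha>\<beta> by linarith
    show ?thesis
    proof (cases "r = 2")
      case True
      hence "istar = 1 \<or> istar = 2" using assms(7) by auto
      hence i3: "I = {3 - istar}" using True by (auto simp: I_def)
      hence UF: "U = F (3 - istar)" by (simp add: U_def)
      have T2: "T = card (F istar) + card U" using T i3 UF by simp
      have M: "max M1 M2 = n choose a" using max M2' True \<alpha>\<beta> by simp
      have "T = max M1 M2 \<longleftrightarrow> card (F istar) = card (nsets V a - complements n U)"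
        using M T2 cU Ule card_minus[OF U] by auto
      also have "\<dots> \<longleftrightarrow> F istar = nsets V a - complements n U"
        using card_subset_eq[OF fminus aU] by auto
      moreover have "1 \<le> card U"
        using kI1(3)[of "3 - istar"] i3 fU UF by (simp add: Suc_le_eq card_gt_0_iff)
      ultimately show ?thesis using True UF U\<beta> by (simp add: a_def \<beta>0_def)
    next
      case False
      hence r: "2 < r" using assms(1) by simp
      have r2: "(r - 1) * \<beta>0 = (r - 2) * \<beta>0 + \<beta>0"
      proof -
        have "r - 1 = Suc (r - 2)" using r by simp
        thus ?thesis by simp
      qed
      define Q where "Q \<F> \<longleftrightarrow> \<F> \<subseteq> nsets V kbar \<and> intersecting \<F> \<and> card \<F> = \<beta>0 \<and>
            (\<forall>i\<in>I. F i = \<F>) \<and> F istar = nsets V a - complements n \<F>" for \<F>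
      \<comment> \<open>When \<open>card U\<close> drops below \<open>\<beta>0\<close>, the bound
        for \<open>F istar\<close> gains the difference once while the other \<open>r - 1\<close>
        families lose it each. For \<open>r > 2\<close> equality therefore forces
        \<open>card U = \<beta>0\<close> and every \<open>F i\<close> to be
        \<open>U\<close>.\<close>
      have forward: "Q U" if eq: "T = max M1 M2"
      proof -
        have T': "card (F istar) + (\<Sum>i\<in>I. card (F i)) = \<alpha> + (r - 1) * \<beta>0" using eq max M2' T by simp
        have sumU: "(\<Sum>i\<in>I. card (F i)) \<le> (r - 1) * card U"
          using sum_mono[of I "\<lambda>i. card (F i)" "\<lambda>_. card U"] FU cI by simp
        have r1: "(r - 1) * card U = (r - 2) * card U + card U"
        proof -
          have "r - 1 = Suc (r - 2)" using r by simp
          thus ?thesis by simp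
        qed
        have "(r - 2) * \<beta>0 \<le> (r - 2) * card U"
          using T' cU Ule sumU r1 r2 \<alpha>\<beta> by linarith
        hence Ub: "card U = \<beta>0" using r U\<beta> by simp
        hence "(\<Sum>i\<in>I. card (F i)) = (\<Sum>i\<in>I. card U)"
          using T' cU sumU \<alpha>\<beta> cI by simp
        hence "card (F i) = card U" if "i \<in> I" for i
          using sum_mono_inv[of "\<lambda>i. card (F i)" I "\<lambda>_. card U" i] FU that I(1) by blast
        hence Fi: "F i = U" if "i \<in> I" for i using card_subset_eq[OF fU FU(1)] that by blast
        have "card (F istar) = \<alpha>" using T' Fi Ub cI by simp
        hence "F istar = nsets V a - complements n U"
          using card_subset_eq[OF fminus aU] card_minus[OF U] Ub \<alpha>\<beta> by simp
        \<comment> \<open>For \<open>r > 2\<close> two different indices carry the same family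
          \<open>U\<close>, so \<open>U\<close> cross-intersects itself.\<close>
        moreover have "intersecting U"
        proof -
          have "card (I - {b}) = r - 2" using cI b I(1) by simp
          hence "I - {b} \<noteq> {}" using r by (metis card.empty zero_less_diff less_irrefl)
          then obtain j where j: "j \<in> I" "j \<noteq> b" by blast
          have "1 \<le> card (A \<inter> B)" if AB: "A \<in> U" "B \<in> U" for A B
          proof -
            have "A \<inter> B \<noteq> {}" using pair_cross[OF Ir(1)[OF b(1)] Ir(1)[OF j(1)] j(2)[symmetric], of A B] AB Fi[OF b(1)] Fi[OF j(1)] by simp
            moreover have "finite (A \<inter> B)" using AB U by (auto simp: nsets_def)
            ultimately show ?thesis by (simp add: Suc_le_eq card_gt_0_iff)
          qed
          thus ?thesis by (simp add: intersecting_def)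
        qed
        ultimately show ?thesis using Fi Ub U by (simp add: Q_def)
      qed
      have backward: "T = max M1 M2" if "card (F istar) = \<alpha>" "\<forall>i\<in>I. card (F i) = \<beta>0"
        using that max M2' T cI by simp
      have Q_back: "T = max M1 M2" if "Q \<F>" for \<F>
        using that card_minus[of \<F>] \<alpha>\<beta> by (intro backward) (auto simp: Q_def)
      show ?thesis
      proof (cases "2 * kbar < n")
        case True
        let ?R1 = "\<exists>x\<in>V. F istar = {A \<in> nsets V a. x \<in> A} \<and> (\<forall>i\<in>I. F i = {A \<in> nsets V kbar. x \<in> A})"
        have "?R1" if "T = max M1 M2"
        proof -
          have Q: "Q U" by (rule forward[OF that])
          \<comment> \<open>For \<open>n > 2 * kbar\<close> the intersecting family
            \<open>U\<close>, paired with itself, satisfies the assumptions of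
            \<open>star\<close>.\<close>
          have "cross_pair V U U kbar kbar"
          proof
            show "A \<inter> B \<noteq> {}" if "A \<in> U" "B \<in> U" for A B
              using Q that by (fastforce simp: Q_def intersecting_def)
          qed (use U V kb1 True in auto)
          then obtain x where x: "x \<in> V" "U = {A \<in> nsets V kbar. x \<in> A}"
            using cross_pair.star[of V U U kbar kbar] Q True V by (auto simp: Q_def \<beta>0_def)
          have "nsets V a - complements n U \<subseteq> {A \<in> nsets V a. x \<in> A}"
          proof
            fix A assume A: "A \<in> nsets V a - complements n U"
            have A': "A \<subseteq> V" "finite A" "card A = a" using A by (auto simp: nsets_def)
            \<comment> \<open>An \<open>a\<close>-set missing \<open>x\<close> is the complement of
              a \<open>kbar\<close>-set through \<open>x\<close>, that is, of a member of
              \<open>U\<close>.\<close>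
            have "x \<in> A"
            proof (rule ccontr)
              assume "x \<notin> A"
              hence "V - A \<in> U" using x A' V small by (auto simp: nsets_iff card_Diff_subset)
              moreover have "A = V - (V - A)" using A' by auto
              ultimately have "A \<in> complements n U" unfolding complements_def V_def by blast
              thus False using A by simp
            qed
            thus "A \<in> {A \<in> nsets V a. x \<in> A}" using A by simp
          qed
          moreover have "card (nsets V a - complements n U) = card {A \<in> nsets V a. x \<in> A}"
            using card_minus[OF U] card_star[OF x(1) kb1(3)] Q \<alpha>\<beta> by (simp add: Q_def \<alpha>_def)
          moreover have "finite {A \<in> nsets V a. x \<in> A}" using finite_imp_finite_nsets[OF V(1)] by simp
          ultimately have "nsets V a - complements n U = {A \<in> nsets V a. x \<in> A}"
            by (intro card_subset_eq)
          thus ?thesis using x Q by (auto simp: Q_def)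
        qed
        moreover have "T = max M1 M2" if ?R1
        proof -
          from that obtain x where x: "x \<in> V" "F istar = {A \<in> nsets V a. x \<in> A}"
            "\<forall>i\<in>I. F i = {A \<in> nsets V kbar. x \<in> A}" by blast
          show ?thesis using x card_star[OF x(1)] kb1 by (intro backward) (auto simp: \<alpha>_def \<beta>0_def)
        qed
        ultimately have "T = max M1 M2 \<longleftrightarrow> ?R1" by blast
        thus ?thesis using r True by (simp add: a_def)
      next
        case False
        have "T = max M1 M2 \<longleftrightarrow> (\<exists>\<F>. Q \<F>)" using forward Q_back by blast
        thus ?thesis using r False by (simp add: Q_def a_def \<beta>0_def)
      qed
    qed
  qed

  \<comment> \<open>Each \<open>k i\<close> lies between \<open>kbar\<close> and
    \<open>n - a\<close>, and these two bounds coincide when \<open>n = kbar + a\<close>.\<close>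
  have sizes: "(\<forall>i\<in>I. k i = kbar) \<and> n = kbar + k istar \<longleftrightarrow> n = kbar + a"
    using kle kI by (fastforce simp: a_def)
  have big_or_small: "n = kbar + a \<or> kbar + a < n" using kb1 by linarith
  show ?thesis
    unfolding Let_def
    unfolding M1_def[symmetric] M2_def[symmetric] T_def[symmetric]
    unfolding I_def[symmetric] V_def[symmetric]
  proof (intro conjI)
    show "T \<le> max M1 M2" by (rule bound)
  next
    show "T = max M1 M2 \<longleftrightarrow>
          ((\<forall>i\<in>I. k i = kbar) \<and> n = kbar + k istar \<longrightarrow>
             (r = 2 \<longrightarrow>
                F istar = nsets V (k istar) - complements n (F (3 - istar)) \<and>
                1 \<le> card (F (3 - istar)) \<and>
                card (F (3 - istar)) \<le> (n - 1) choose (kbar - 1)) \<and>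
             (r > 2 \<and> n > 2 * kbar \<longrightarrow>
                (\<exists>x\<in>V.
                   F istar = {A \<in> nsets V (k istar). x \<in> A} \<and>
                   (\<forall>i\<in>I. F i = {A \<in> nsets V kbar. x \<in> A}))) \<and>
             (r > 2 \<and> n \<le> 2 * kbar \<longrightarrow>
                (\<exists>\<F>. \<F> \<subseteq> nsets V kbar \<and> intersecting \<F> \<and>
                   card \<F> = (n - 1) choose (kbar - 1) \<and>
                   (\<forall>i\<in>I. F i = \<F>) \<and>
                   F istar = nsets V (k istar) - complements n \<F>))) \<and>
          (n > kbar + k istar \<longrightarrow>
             (\<exists>s. (s = 1 \<and> M2 = max M1 M2 \<or> s = kbar \<and> M1 = max M1 M2) \<and>
                (\<exists>S\<in>nsets V s.
                   F istar = {A \<in> nsets V (k istar). S \<inter> A \<noteq> {}} \<and>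
                   (\<forall>i\<in>I. F i = {A \<in> nsets V (k i). S \<subseteq> A}))))"
    proof (cases "n = kbar + a")
      case True
      hence "\<forall>i\<in>I. k i = kbar" "n = kbar + k istar" "\<not> n > kbar + k istar"
        using sizes by (auto simp: a_def)
      thus ?thesis using eq_small[OF True] by simp
    next
      case False
      hence "kbar + a < n" "n \<noteq> kbar + k istar" "n > kbar + k istar"
        using big_or_small by (auto simp: a_def)
      thus ?thesis using eq_big by simp
    qed
  qed
qed

end
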